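(* The pair $(\bar y,\bar v)\in\mathcal{T}$ defined for $s\in[0,1]$ by $$\bar y(s)=(\bar y^{(1)}(s),\bar y^{(2)}(s),\bar\xi(s))=(\tilde x(s),\tilde x(s+1),\bar\tau),\qquad \bar v(s)=(\bar v^{(1)}(s),\bar v^{(2)}(s))=(\tilde u(s),\tilde u(s+1)),$$ where $\bar\tau$ is the unique crossing time of $\bar x$, $\tilde u=\bar u\circ\pi_{\bar\tau}$ and $\tilde x=\bar x\circ\pi_{\bar\tau}$, is a weak minimum of problem $(\mathrm{P})$.
   Context: **Time crisis problem and standing assumptions.** Fix $T>0$, positive integers $n,m,l$ and $x_0\in\mathbb{R}^n$; $|\cdot|$ is the Euclidean norm. $U\subset\mathbb{R}^m$ is non-empty and closed; $f:\mathbb{R}^n\times\mathbb{R}^m\to\mathbb{R}^n$ is of class $C^2$; there are $c_1,c_2>0$ with $|f(x,u)|\le c_1|x|+c_2$ for all $x\in\mathbb{R}^n$, $u\in U$; for every $x$ the set $\{f(x,u):u\in U\}$ is non-empty, compact and convex; $\phi:\mathbb{R}^n\to\mathbb{R}$ is of class $C^2$; $K\subset\mathbb{R}^n$ is closed with non-empty interior, $K^c$ is its complement and $\mathds{1}_{K^c}$ the indicator function of $K^c$ (value $1$ on $K^c$, $0$ on $K$). Let $\mathcal{U}$ be the set of measurable $u:[0,T]\to U$ and, for $u\in\mathcal{U}$, let $x_u$ be the unique solution on $[0,T]$ of $\dot x=f(x,u)$, $x(0)=x_0$. The time crisis problem is to minimize over $u\in\mathcal{U}$ the cost $J_T(u)=\phi(x_u(T))+\int_0^T\mathds{1}_{K^c}(x_u(t))\,dt$.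 Fix a global minimizer $\bar u\in\mathcal{U}$ and set $\bar x=x_{\bar u}$. It is assumed that: - There is $c:\mathbb{R}^m\to\mathbb{R}^l$ of class $C^2$ with $U=\{u: c_i(u)\le 0,\ 1\le i\le l\}$, and there are $\varepsilon,\delta>0$ such that, with $I(t)=\{i: c_i(\bar u(t))\ge-\delta\}$, one has $\varepsilon|\xi|\le\big|\sum_{i\in I(t)}\xi_i\nabla c_i(\bar u(t))\big|$ for all $\xi\in\mathbb{R}^{I(t)}$, for a.e. $t\in(0,T)$. - There is $g:\mathbb{R}^n\to\mathbb{R}$ of class $C^1$ with $K=\{x: g(x)\le 0\}$. - $\bar x$ has exactly one crossing time $\bar\tau\in(0,T)$; it is a transverse crossing time from $K$ to $K^c$: there is $\eta>0$ with $\bar x(t)\in K$ for $t\in(\bar\tau-\eta,\bar\tau]$ and $\bar x(t)\in K^c$ for $t\in(\bar\tau,\bar\tau+\eta)$; $\bar u$ is left- and right-continuous at $\bar\tau$ (one-sided limits $\bar u(\bar\tau^\pm)$ exist); and $\dot{\bar x}(\bar\tau^\pm)\cdot\nabla g(\bar x(\bar\tau))\ne0$, where $\dot{\bar x}(\bar\tau^\pm)=f(\bar x(\bar\tau),\bar u(\bar\tau^\pm))$. Moreover $g(\bar x(t))\neq0$ for all $t\in[0,T]\setminus\{\bar\tau\}$ (so $x_0\in\mathrm{Int}(K)$). **Time change.** For $\tau\in(0,T)$, $\pi_\tau:[0,2]\to[0,T]$ is $\pi_\tau(s)=\tau s$ for $s\in[0,1]$ and $\pi_\tau(s)=(T-\tau)s+2\tau-T$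 for $s\in[1,2]$. **Problem $(\mathrm{P})$.** Write $y=(y^{(1)},y^{(2)},\xi)\in\mathbb{R}^{n}\times\mathbb{R}^n\times\mathbb{R}$, $v=(v^{(1)},v^{(2)})\in\mathbb{R}^m\times\mathbb{R}^m$, and $$F(y,v)=\big(\xi f(y^{(1)},v^{(1)}),\ (T-\xi)f(y^{(2)},v^{(2)}),\ 0\big),\qquad G(y_0,y_1)=\big(y_0^{(1)},\ \xi_0,\ y_0^{(2)}-y_1^{(1)},\ g(y_1^{(1)})\big)\in\mathbb{R}^{2n+2},$$ $C=\{x_0\}\times(0,T)\times\{0_{\mathbb{R}^n}\}\times\{0\}$, $\psi(y)=\phi(y^{(2)})+T-\xi$. $\mathcal{V}$ is the set of measurable $v:[0,1]\to U\times U$, and $\mathcal{T}$ is the set of pairs $(y,v)$ with $v\in\mathcal{V}$ and $y$ an (absolutely continuous) solution of $\frac{dy}{ds}(s)=F(y(s),v(s))$ on $[0,1]$. Problem $(\mathrm{P})$ is: minimize $\psi(y(1))$ over $(y,v)\in\mathcal{T}$ subject to $G(y(0),y(1))\in C$. **Weak minimum.** $(\bar y,\bar v)\in\mathcal{T}$ is a weak minimum of $(\mathrm{P})$ if $G(\bar y(0),\bar y(1))\in C$ and there exists $\varepsilon>0$ such that for all $(y,v)\in\mathcal{T}$ with $G(y(0),y(1))\in C$, $|y(0)-\bar y(0)|\le\varepsilon$ and $\|v-\bar v\|_{L^\infty(0,1;\mathbb{R}^{2m})}\le\varepsilon$, one has $\psi(\bar y(1))\le\psi(y(1))$. *)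

theory Defs
  imports "HOL-Analysis.Analysis" "HOL-Probability.Essential_Supremum"
begin

section \<open>Regularity and Caratheodory solutions\<close>

definition of_class_C1 :: "('a::real_normed_vector \<Rightarrow> 'b::real_normed_vector) \<Rightarrow> bool" where
  "of_class_C1 h \<longleftrightarrow>
     (\<exists>h' :: 'a \<Rightarrow> 'a \<Rightarrow>\<^sub>L 'b.
        (\<forall>x. (h has_derivative blinfun_apply (h' x)) (at x)) \<and> continuous_on UNIV h')"

definition of_class_C2 :: "('a::real_normed_vector \<Rightarrow> 'b::real_normed_vector) \<Rightarrow> bool" where
  "of_class_C2 h \<longleftrightarrow>
     (\<exists>h' :: 'a \<Rightarrow> 'a \<Rightarrow>\<^sub>L 'b.
        (\<forall>x. (h has_derivative blinfun_apply (h' x)) (at x)) \<and> of_class_C1 h')"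

definition gradient :: "('a::real_inner \<Rightarrow> real) \<Rightarrow> 'a \<Rightarrow> 'a" where
  "gradient h x = (THE D. GDERIV h x :> D)"

text \<open>The usual epsilon-delta definition: \<open>d\<close> ranges over the finite families of
  non-overlapping compact subintervals of \<open>S\<close>.\<close>

definition abs_continuous_on :: "real set \<Rightarrow> (real \<Rightarrow> 'a::real_normed_vector) \<Rightarrow> bool" where
  "abs_continuous_on S x \<longleftrightarrow>
     (\<forall>\<epsilon>>0. \<exists>\<delta>>0. \<forall>d. d division_of \<Union>d \<and> \<Union>d \<subseteq> S \<and> (\<Sum>k\<in>d. Sup k - Inf k) < \<delta>
        \<longrightarrow> (\<Sum>k\<in>d. norm (x (Sup k) - x (Inf k))) < \<epsilon>)"

definition ode_solution ::
  "(real \<Rightarrow> 'a::real_normed_vector \<Rightarrow> 'a) \<Rightarrow> real \<Rightarrow> real \<Rightarrow> (real \<Rightarrow> 'a) \<Rightarrow> bool" where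
  "ode_solution h a b x \<longleftrightarrow>
     abs_continuous_on {a..b} x \<and>
     (AE t in lebesgue_on {a..b}. (x has_vector_derivative h t (x t)) (at t within {a..b}))"

definition controls :: "real \<Rightarrow> real \<Rightarrow> 'a::euclidean_space set \<Rightarrow> (real \<Rightarrow> 'a) set" where
  "controls a b U = {u. u \<in> borel_measurable (lebesgue_on {a..b}) \<and> (\<forall>t\<in>{a..b}. u t \<in> U)}"


section \<open>The time crisis problem\<close>

text \<open>Trajectories are functions on \<open>[0,T]\<close>, hence the normalisation outside that interval.
  The description operator in \<open>trajectory\<close> is meaningful only if each control has exactly one
  trajectory. This does not follow from linear growth and smoothness of \<open>f\<close> when controls may be
  unbounded: \<open>f x u = sin (u * x)\<close> with \<open>u t = 2/t\<close> and initial state \<open>0\<close> has the trajectories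
  \<open>0\<close> and \<open>c * t\<close> whenever \<open>c = sin (2 * c)\<close>. So unique solvability has to be assumed.\<close>

definition is_trajectory ::
  "(real^'n \<Rightarrow> real^'m \<Rightarrow> real^'n) \<Rightarrow> real^'n \<Rightarrow> real \<Rightarrow> (real \<Rightarrow> real^'m) \<Rightarrow> (real \<Rightarrow> real^'n) \<Rightarrow> bool"
  where
  "is_trajectory f x0 T u x \<longleftrightarrow>
     x \<in> extensional {0..T} \<and> ode_solution (\<lambda>t z. f z (u t)) 0 T x \<and> x 0 = x0"

definition trajectory ::
  "(real^'n \<Rightarrow> real^'m \<Rightarrow> real^'n) \<Rightarrow> real^'n \<Rightarrow> real \<Rightarrow> (real \<Rightarrow> real^'m) \<Rightarrow> real \<Rightarrow> real^'n" where
  "trajectory f x0 T u = (THE x. is_trajectory f x0 T u x)"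

definition crisis_cost ::
  "(real^'n \<Rightarrow> real^'m \<Rightarrow> real^'n) \<Rightarrow> (real^'n \<Rightarrow> real) \<Rightarrow> (real^'n) set \<Rightarrow> real^'n \<Rightarrow> real \<Rightarrow>
     (real \<Rightarrow> real^'m) \<Rightarrow> real" where
  "crisis_cost f \<phi> K x0 T u =
     \<phi> (trajectory f x0 T u T) + integral {0..T} (\<lambda>t. indicator (- K) (trajectory f x0 T u t))"

definition global_minimizer ::
  "(real^'n \<Rightarrow> real^'m \<Rightarrow> real^'n) \<Rightarrow> (real^'n \<Rightarrow> real) \<Rightarrow> (real^'n) set \<Rightarrow> real^'n \<Rightarrow> real \<Rightarrow>
     (real^'m) set \<Rightarrow> (real \<Rightarrow> real^'m) \<Rightarrow> bool" where
  "global_minimizer f \<phi> K x0 T U u \<longleftrightarrow>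
     u \<in> controls 0 T U \<and>
     (\<forall>w\<in>controls 0 T U. crisis_cost f \<phi> K x0 T u \<le> crisis_cost f \<phi> K x0 T w)"

text \<open>At a crossing time in either direction the trajectory itself lies in the closed set \<open>K\<close>.\<close>

definition exit_crossing :: "'a set \<Rightarrow> (real \<Rightarrow> 'a) \<Rightarrow> real \<Rightarrow> bool" where
  "exit_crossing K x \<tau> \<longleftrightarrow>
     (\<exists>\<eta>>0. (\<forall>t\<in>{\<tau>-\<eta><..\<tau>}. x t \<in> K) \<and> (\<forall>t\<in>{\<tau><..<\<tau>+\<eta>}. x t \<in> - K))"

definition entry_crossing :: "'a set \<Rightarrow> (real \<Rightarrow> 'a) \<Rightarrow> real \<Rightarrow> bool" where
  "entry_crossing K x \<tau> \<longleftrightarrow>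
     (\<exists>\<eta>>0. (\<forall>t\<in>{\<tau>-\<eta><..<\<tau>}. x t \<in> - K) \<and> (\<forall>t\<in>{\<tau>..<\<tau>+\<eta>}. x t \<in> K))"

definition crossing_times :: "'a set \<Rightarrow> real \<Rightarrow> (real \<Rightarrow> 'a) \<Rightarrow> real set" where
  "crossing_times K T x = {\<tau>\<in>{0<..<T}. exit_crossing K x \<tau> \<or> entry_crossing K x \<tau>}"


section \<open>The reformulated problem (P) on \<open>[0,1]\<close>\<close>

definition time_change :: "real \<Rightarrow> real \<Rightarrow> real \<Rightarrow> real" where
  "time_change T \<tau> s = (if s \<le> 1 then \<tau> * s else (T - \<tau>) * s + 2 * \<tau> - T)"

text \<open>The norm of a product type is Euclidean, so the states \<open>(y1, y2, \<xi>)\<close> and the controls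
  \<open>(v1, v2)\<close> below carry the Euclidean norms of dimension \<open>2n+1\<close> and \<open>2m\<close>.\<close>

definition P_dynamics ::
  "(real^'n \<Rightarrow> real^'m \<Rightarrow> real^'n) \<Rightarrow> real \<Rightarrow>
     (real^'n) \<times> (real^'n) \<times> real \<Rightarrow> (real^'m) \<times> (real^'m) \<Rightarrow> (real^'n) \<times> (real^'n) \<times> real" where
  "P_dynamics f T = (\<lambda>(y1, y2, \<xi>) (v1, v2). (\<xi> *\<^sub>R f y1 v1, (T - \<xi>) *\<^sub>R f y2 v2, 0))"

definition P_endpoint ::
  "(real^'n \<Rightarrow> real) \<Rightarrow> (real^'n) \<times> (real^'n) \<times> real \<Rightarrow> (real^'n) \<times> (real^'n) \<times> real \<Rightarrow>
     (real^'n) \<times> real \<times> (real^'n) \<times> real" where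
  "P_endpoint g = (\<lambda>(a1, a2, \<xi>0) (b1, b2, \<xi>1). (a1, \<xi>0, a2 - b1, g b1))"

definition P_target :: "real^'n \<Rightarrow> real \<Rightarrow> ((real^'n) \<times> real \<times> (real^'n) \<times> real) set" where
  "P_target x0 T = {x0} \<times> {0<..<T} \<times> {0} \<times> {0}"

definition P_cost :: "(real^'n \<Rightarrow> real) \<Rightarrow> real \<Rightarrow> (real^'n) \<times> (real^'n) \<times> real \<Rightarrow> real" where
  "P_cost \<phi> T = (\<lambda>(y1, y2, \<xi>). \<phi> y2 + T - \<xi>)"

definition P_trajectories ::
  "(real^'n \<Rightarrow> real^'m \<Rightarrow> real^'n) \<Rightarrow> real \<Rightarrow> (real^'m) set \<Rightarrow>
     ((real \<Rightarrow> (real^'n) \<times> (real^'n) \<times> real) \<times> (real \<Rightarrow> (real^'m) \<times> (real^'m))) set" where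
  "P_trajectories f T U =
     {(y, v). v \<in> controls 0 1 (U \<times> U) \<and> ode_solution (\<lambda>s z. P_dynamics f T z (v s)) 0 1 y}"

definition P_weak_minimum ::
  "(real^'n \<Rightarrow> real^'m \<Rightarrow> real^'n) \<Rightarrow> (real^'n \<Rightarrow> real) \<Rightarrow> (real^'n \<Rightarrow> real) \<Rightarrow>
     real^'n \<Rightarrow> real \<Rightarrow> (real^'m) set \<Rightarrow>
     (real \<Rightarrow> (real^'n) \<times> (real^'n) \<times> real) \<Rightarrow> (real \<Rightarrow> (real^'m) \<times> (real^'m)) \<Rightarrow> bool" where
  "P_weak_minimum f g \<phi> x0 T U yb vb \<longleftrightarrow>
     (yb, vb) \<in> P_trajectories f T U \<and>
     P_endpoint g (yb 0) (yb 1) \<in> P_target x0 T \<and>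
     (\<exists>\<epsilon>>0. \<forall>(y, v)\<in>P_trajectories f T U.
        P_endpoint g (y 0) (y 1) \<in> P_target x0 T \<and>
        norm (y 0 - yb 0) \<le> \<epsilon> \<and>
        esssup (lebesgue_on {0..1}) (\<lambda>s. ereal (norm (v s - vb s))) \<le> ereal \<epsilon>
        \<longrightarrow> P_cost \<phi> T (yb 1) \<le> P_cost \<phi> T (y 1))"

end

(* Concatenating the two halves of an admissible pair (y, v) of problem (P) gives a control u on [0,T]
   with trajectory x, and x meets the boundary of K at time xi. If x stays in K on [0,xi], then
   J_T(u) <= phi(x(T)) + T - xi = psi(y(1)), while psi(ybar(1)) = J_T(ubar), so global minimality of
   ubar gives the inequality. It remains to see that x stays in K on [0,xi] as soon as (y, v) is close
   to (ybar, vbar). Otherwise there is a sequence of counterexamples converging to (ybar, vbar); by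
   Arzela-Ascoli and uniqueness of the trajectory of ubar, y^(1) converges uniformly to ybar^(1) along
   a subsequence. Away from s = 1 the function g is negative along the limit. Near s = 1 it increases
   along y^(1), because ubar has a left limit at the crossing time and the crossing is transverse,
   and it vanishes at s = 1. *)
theory Submission
  imports Defs "HOL-Complex_Analysis.Great_Picard"
begin

hide_const (open) Polynomial.content

section \<open>Absolute continuity and the fundamental theorem of calculus\<close>

text \<open>Closeness of the controls in the essential supremum norm is what settles the behaviour
  near s = 1: uniformly close curves could still leave K and return just before the end, whereas
  controls that are a.e. near the left limit of ubar fix the sign of the derivative of g along the
  curve. Transversality is given only as a nonzero derivative; its positive sign on arrival comes
  from g being negative before the crossing time and zero at it. After xi the running cost is at
  most T - xi whatever the trajectory does, so only the first half of the curve has to be kept in K.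

  Solutions are defined by absolute continuity and an a.e. derivative, a form that does not pass to
  limits directly. They are replaced by integral equations, which do pass to limits under bounded
  a.e. convergence of the integrands. The equivalence of the two forms rests on two facts about the
  gauge integral: the fundamental theorem of calculus for absolutely continuous functions, and the
  a.e. differentiability of indefinite integrals.\<close>

lemma AE_lebesgue_on_iff_negligible:
  assumes "S \<in> sets lebesgue"
  shows "(AE t in lebesgue_on S. P t) \<longleftrightarrow> negligible {t\<in>S. \<not> P t}"
proof -
  have "(AE t in lebesgue_on S. P t) \<longleftrightarrow> (AE t in lebesgue. t \<in> S \<longrightarrow> P t)"
    using assms by (subst AE_restrict_space_iff) auto
  also have "\<dots> \<longleftrightarrow> {t\<in>S. \<not> P t} \<in> null_sets lebesgue"
    by (subst completion.AE_iff_null_sets) auto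
  finally show ?thesis
    by (simp add: negligible_iff_null_sets)
qed

text \<open>Non-overlapping intervals meet in convex sets with empty interior, hence in null sets,
  so their lengths add up to the measure of the union. The measure of a set containing the intervals
  then bounds their total length.\<close>

lemma sum_content_division_of:
  fixes d :: "'a::euclidean_space set set"
  assumes "d division_of \<Union>d"
  shows "(\<Sum>K\<in>d. content K) = measure lebesgue (\<Union>d)"
proof -
  note D = division_ofD[OF assms]
  have *: "K \<in> lmeasurable" if "K \<in> d" for K
    using D(4)[OF that] by auto
  have "pairwise (\<lambda>S T. negligible (S \<inter> T)) d"
  proof (rule pairwiseI)
    fix S S' assume S: "S \<in> d" "S' \<in> d" "S \<noteq> S'"
    then obtain p q p' q' where pq: "S = cbox p q" "S' = cbox p' q'"
      using D(4) by meson
    moreover have "interior (S \<inter> S') = {}"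
      using D(5)[OF S] by simp
    ultimately show "negligible (S \<inter> S')"
      by (metis negligible_convex_interior convex_box(1) convex_Int)
  qed
  then have "measure lebesgue (\<Union>d) = (\<Sum>K\<in>d. measure lebesgue K)"
    using D(1) * by (intro measure_negligible_finite_Union) auto
  also have "\<dots> = (\<Sum>K\<in>d. content K)"
  proof (rule sum.cong)
    fix K assume "K \<in> d"
    then obtain p q where "K = cbox p q"
      using D(4) by blast
    then show "measure lebesgue K = content K"
      by (simp add: measure_completion)
  qed auto
  finally show ?thesis ..
qed

text \<open>If two distinct pairs shared an interval, it would have empty interior, hence be a
  single point equal to both tags. Sums over tagged intervals thus become sums over sets of
  intervals, the form in which \<open>abs_continuous_on\<close> is stated.\<close>

lemma inj_on_snd_tagged_partial_division:
  fixes p :: "(real \<times> real set) set"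
  assumes "p tagged_partial_division_of S"
  shows "inj_on snd p"
proof (rule inj_onI)
  fix A B assume AB: "A \<in> p" "B \<in> p" "snd A = snd B"
  obtain s t K where st: "A = (s, K)" "B = (t, K)"
    using AB(3) by (metis prod.collapse)
  note D = tagged_partial_division_ofD[OF assms]
  have in_K: "s \<in> K" "t \<in> K"
    using D(2) AB st by auto
  show "A = B"
  proof (rule ccontr)
    assume "A \<noteq> B"
    then have "interior K \<inter> interior K = {}"
      using D(5) AB st by blast
    moreover obtain u v where "K = {u..v}"
      using D(4)[of s K] AB st by (metis box_real(2))
    ultimately have "u = v"
      using in_K by auto
    then show False
      using \<open>K = {u..v}\<close> in_K \<open>A \<noteq> B\<close> st by auto
  qed
qed

text \<open>The gauge treats two kinds of tags. Outside \<open>N\<close> differentiability controls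
  the error. At tags in \<open>N\<close> the integrand is put to zero and the intervals are confined
  to an open set of measure below the \<delta> of absolute continuity, so the increments of
  \<open>x\<close> over them are small in total. Integrability of \<open>h\<close> is part of the
  conclusion.\<close>

theorem abs_continuous_has_integral:
  fixes x h :: "real \<Rightarrow> 'a::banach"
  assumes "a \<le> b" and ac: "abs_continuous_on {a..b} x" and N: "negligible N"
    and deriv: "\<And>t. t \<in> {a..b} - N \<Longrightarrow> (x has_vector_derivative h t) (at t within {a..b})"
  shows "(h has_integral (x b - x a)) {a..b}"
proof (cases "a = b")
  case True
  then show ?thesis using has_integral_refl(2)[of h b] by simp
next
  case False
  then have "a < b" using \<open>a \<le> b\<close> by simp
  define k where "k t = (if t \<in> N then 0 else h t)" for t
  have "(k has_integral (x b - x a)) {a..b}"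
    unfolding has_integral_factor_content_real
  proof (intro allI impI)
    fix e :: real assume "e > 0"
    \<comment> \<open>Half of the admissible error \<open>e * (b - a)\<close> is reserved for the
      tags in \<open>N\<close>, the other half for the remaining ones.\<close>
    have "e * (b - a) / 2 > 0"
      using \<open>e > 0\<close> \<open>a < b\<close> by simp
    from ac[unfolded abs_continuous_on_def, rule_format, OF this]
    obtain \<delta> where "\<delta> > 0" and ac_\<delta>: "\<forall>d. d division_of \<Union>d \<and> \<Union>d \<subseteq> {a..b} \<and> (\<Sum>K\<in>d. Sup K - Inf K) < \<delta>
          \<longrightarrow> (\<Sum>K\<in>d. norm (x (Sup K) - x (Inf K))) < e * (b - a) / 2"
      by (elim exE conjE)
    have \<delta>: "(\<Sum>K\<in>d. norm (x (Sup K) - x (Inf K))) < e * (b - a) / 2"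
      if "d division_of \<Union>d" "\<Union>d \<subseteq> {a..b}" "(\<Sum>K\<in>d. Sup K - Inf K) < \<delta>" for d
      using ac_\<delta>[rule_format, of d] that by simp
    have "N \<in> sets lebesgue"
      using N negligible_imp_sets by blast
    then obtain W where "open W" "N \<subseteq> W" and W: "W - N \<in> lmeasurable" "emeasure lebesgue (W - N) < ennreal \<delta>"
      using \<open>\<delta> > 0\<close> by (rule sets_lebesgue_outer_open)
    have W_lmeas: "W \<in> lmeasurable"
      using W(1) N \<open>N \<subseteq> W\<close> by (metis Diff_partition fmeasurable.Un negligible_imp_measurable)
    have "measure lebesgue W = measure lebesgue (W - N)"
      using N W_lmeas by (simp add: measure_Diff_null_set negligible_iff_null_sets fmeasurableD)
    then have W_less: "measure lebesgue W < \<delta>"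
      using W by (simp add: emeasure_eq_measure2 ennreal_less_iff)
    have "\<exists>d>0. t \<in> {a..b} - N \<longrightarrow>
         (\<forall>y\<in>{a..b}. norm (y-t) < d \<longrightarrow> norm (x y - x t - (y-t) *\<^sub>R h t) \<le> e/2 * norm (y-t))" for t
    proof (cases "t \<in> {a..b} - N")
      case True
      then show ?thesis
        using deriv[OF True] half_gt_zero[OF \<open>e > 0\<close>]
        unfolding has_vector_derivative_def has_derivative_within_alt by blast
    qed (auto intro: zero_less_one)
    then obtain d where d: "\<And>t. 0 < d t"
       "\<And>t y. \<lbrakk>t \<in> {a..b} - N; y \<in> {a..b}; norm (y-t) < d t\<rbrakk>
            \<Longrightarrow> norm (x y - x t - (y-t) *\<^sub>R h t) \<le> e/2 * norm (y-t)"
      by metis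
    define \<gamma> where "\<gamma> t = (if t \<in> N then W else ball t (d t))" for t
    have "gauge \<gamma>"
      using \<open>open W\<close> \<open>N \<subseteq> W\<close> d(1) by (auto simp: gauge_def \<gamma>_def)
    moreover have "norm ((\<Sum>(t, K)\<in>p. content K *\<^sub>R k t) - (x b - x a)) \<le> e * content {a..b}"
      if ptag: "p tagged_division_of {a..b}" and fine: "\<gamma> fine p" for p
    proof -
      have ba: "b - a = (\<Sum>(t,K)\<in>p. Sup K - Inf K)" "x b - x a = (\<Sum>(t,K)\<in>p. x (Sup K) - x (Inf K))"
        using additive_tagged_division_1[where f= "\<lambda>x. x"] additive_tagged_division_1[where f= x]
            \<open>a \<le> b\<close> ptag by auto
      note ptagD = tagged_division_ofD[OF ptag]
      note [simp] = ptagD(1)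
      have K_cases: "\<exists>u v. K = {u..v} \<and> u \<le> t \<and> t \<le> v \<and> a \<le> u \<and> v \<le> b" if "(t, K) \<in> p" for t K
      proof -
        obtain u v where "K = {u..v}"
          using ptagD(4)[OF \<open>(t, K) \<in> p\<close>] by (metis box_real(2))
        then show ?thesis
          using ptagD(2,3)[OF \<open>(t, K) \<in> p\<close>] by auto
      qed
      define q where "q = {A\<in>p. fst A \<in> N}"
      have [simp]: "finite q" by (simp add: q_def)
      have q_part: "q tagged_partial_division_of {a..b}"
        using ptag unfolding tagged_division_of_def
        by (auto simp: q_def intro: tagged_partial_division_subset)
      have inj: "inj_on snd q"
        by (rule inj_on_snd_tagged_partial_division[OF q_part])
      have q_bound: "(\<Sum>(t,K)\<in>q. norm (x (Sup K) - x (Inf K))) < e * (b - a) / 2"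
      proof -
        have div: "snd ` q division_of \<Union>(snd ` q)"
          using q_part by (rule partial_division_of_tagged_division)
        have "(\<Sum>K\<in>snd ` q. Sup K - Inf K) = (\<Sum>K\<in>snd ` q. content K)"
        proof (rule sum.cong)
          fix K assume "K \<in> snd ` q"
          then obtain t where "(t, K) \<in> p" by (auto simp: q_def)
          then show "Sup K - Inf K = content K"
            using K_cases[of t K] by auto
        qed auto
        also have "\<dots> = measure lebesgue (\<Union>(snd ` q))"
          using div by (rule sum_content_division_of)
        also have "\<dots> \<le> measure lebesgue W"
        proof (rule measure_mono_fmeasurable)
          show "\<Union>(snd ` q) \<subseteq> W"
          proof -
            have "K \<subseteq> W" if "(t, K) \<in> q" for t K
              using fineD[OF fine, of t K] that by (simp add: q_def \<gamma>_def)
            then show ?thesis by fastforce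
          qed
          show "\<Union>(snd ` q) \<in> sets lebesgue"
            using division_ofD(1,4)[OF div] by (intro sets.finite_Union) fastforce+
        qed fact
        finally have "(\<Sum>K\<in>snd ` q. Sup K - Inf K) < \<delta>"
          using W_less by simp
        moreover have "\<Union>(snd ` q) \<subseteq> {a..b}"
          proof -
          have "K \<subseteq> {a..b}" if "(t, K) \<in> q" for t K
            using ptagD(3)[of t K] that by (simp add: q_def)
          then show ?thesis by fastforce
        qed
        ultimately have "(\<Sum>K\<in>snd ` q. norm (x (Sup K) - x (Inf K))) < e * (b - a) / 2"
          using div by (intro \<delta>) auto
        then show ?thesis
          by (simp add: sum.reindex[OF inj] split_def)
      qed
      have good: "norm (content K *\<^sub>R k t - (x (Sup K) - x (Inf K))) \<le> e/2 * (Sup K - Inf K)"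
        if "(t, K) \<in> p - q" for t K
      proof -
        obtain u v where uv: "K = {u..v}" "u \<le> t" "t \<le> v" "a \<le> u" "v \<le> b"
          using K_cases \<open>(t, K) \<in> p - q\<close> by blast
        have t: "t \<in> {a..b} - N"
          using that uv by (auto simp: q_def)
        have sub: "K \<subseteq> ball t (d t)"
          using fineD[OF fine, of t K] that t by (simp add: \<gamma>_def)
        have uv_in: "u \<in> ball t (d t)" "v \<in> ball t (d t)"
          using uv by (auto intro!: subsetD[OF sub] simp del: mem_ball)
        \<comment> \<open>Straddle estimate: the tag lies between \<open>u\<close> and
          \<open>v\<close>, so the errors on its two sides add up to a multiple of
          \<open>v - u\<close>.\<close>
        have "norm (x u - x t - (u - t) *\<^sub>R h t) \<le> e/2 * norm (u - t)"
          using uv_in uv t by (intro d(2)) (auto simp: dist_real_def)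
        moreover have "norm (x v - x t - (v - t) *\<^sub>R h t) \<le> e/2 * norm (v - t)"
          using uv_in uv t by (intro d(2)) (auto simp: dist_real_def)
        moreover have "norm ((v - u) *\<^sub>R h t - (x v - x u)) \<le> norm (x u - x t - (u - t) *\<^sub>R h t) + norm (x v - x t - (v - t) *\<^sub>R h t)"
          using norm_triangle_ineq4[of "x u - x t - (u - t) *\<^sub>R h t" "x v - x t - (v - t) *\<^sub>R h t"]
          by (simp add: algebra_simps)
        ultimately have "norm ((v - u) *\<^sub>R h t - (x v - x u)) \<le> e/2 * norm (u - t) + e/2 * norm (v - t)"
          by linarith
        also have "\<dots> = e/2 * (v - u)"
          using uv by (simp add: field_simps)
        finally show ?thesis
          using uv t by (simp add: k_def)
      qed
      let ?D = "\<lambda>(t, K). content K *\<^sub>R k t - (x (Sup K) - x (Inf K))"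
      have "(\<Sum>(t, K)\<in>p. content K *\<^sub>R k t) - (x b - x a) = sum ?D p"
        by (simp add: ba split_def sum_subtractf)
      also have "\<dots> = sum ?D q + sum ?D (p - q)"
        by (subst sum.subset_diff[of q p]) (auto simp: q_def add.commute)
      finally have split: "norm ((\<Sum>(t, K)\<in>p. content K *\<^sub>R k t) - (x b - x a)) \<le> norm (sum ?D q) + norm (sum ?D (p - q))"
        by (simp add: norm_triangle_ineq)
      have "norm (sum ?D q) \<le> (\<Sum>(t,K)\<in>q. norm (x (Sup K) - x (Inf K)))"
        by (rule sum_norm_le) (auto simp: q_def k_def norm_minus_commute)
      then have on_q: "norm (sum ?D q) \<le> e * (b - a) / 2"
        using q_bound by simp
      have "norm (sum ?D (p - q)) \<le> (\<Sum>(t,K)\<in>p - q. e/2 * (Sup K - Inf K))"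
        by (rule sum_norm_le) (use good in auto)
      also have "\<dots> \<le> (\<Sum>(t,K)\<in>p. e/2 * (Sup K - Inf K))"
      proof (rule sum_mono2)
        fix A assume "A \<in> p - (p - q)"
        then show "0 \<le> (case A of (t, K) \<Rightarrow> e/2 * (Sup K - Inf K))"
          using K_cases[of "fst A" "snd A"] \<open>e > 0\<close> by (cases A) auto
      qed auto
      also have "\<dots> = e/2 * (b - a)"
        by (simp add: ba split_def sum_distrib_left)
      finally show ?thesis
        using split on_q \<open>a < b\<close> by (simp add: algebra_simps)
    qed
    ultimately show "\<exists>d. gauge d \<and> (\<forall>p. p tagged_division_of {a..b} \<and> d fine p \<longrightarrow>
        norm ((\<Sum>(t, K)\<in>p. content K *\<^sub>R k t) - (x b - x a)) \<le> e * content {a..b})"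
      by (intro exI[of _ \<gamma>] conjI allI impI) auto
  qed
  then show ?thesis
    by (rule has_integral_spike[OF N, rotated]) (auto simp: k_def)
qed

text \<open>The points where the difference quotients of the primitive stay away from \<open>h\<close> by a fixed
  amount are Vitali-covered by intervals on which \<open>h\<close> is badly approximated by its tag; Henstock's
  lemma bounds the total length of any disjoint family of them.\<close>

theorem AE_has_vector_derivative_indefinite_integral:
  fixes h :: "real \<Rightarrow> 'a::euclidean_space"
  assumes h: "h integrable_on {a..b}"
  shows "AE t in lebesgue_on {a..b}. ((\<lambda>s. integral {a..s} h) has_vector_derivative h t) (at t within {a..b})"
proof -
  define F where "F s = integral {a..s} h" for s
  define R where "R s t = norm (F s - F t - (s - t) *\<^sub>R h t)" for s t
  define E where "E m = {t\<in>{a..b}. \<forall>d>0. \<exists>s\<in>{a..b}. s \<noteq> t \<and> \<bar>s - t\<bar> < d \<and> \<bar>s - t\<bar> < Suc m * R s t}" for m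
  have F_diff: "F s - F t = integral {t..s} h" if "a \<le> t" "t \<le> s" "s \<le> b" for s t
  proof -
    have "h integrable_on {a..s}"
      using h that by (auto intro: integrable_subinterval_real)
    then show ?thesis
      using that Henstock_Kurzweil_Integration.integral_combine[of a t s h] by (simp add: F_def algebra_simps)
  qed
  have "negligible (E m)" for m
    unfolding negligible_outer_le
  proof (intro allI impI)
    fix e :: real assume "e > 0"
    \<comment> \<open>The tolerance \<open>e / Suc m\<close> compensates the factor in
      \<open>E m\<close>: a bad interval is shorter than \<open>Suc m\<close> times its Henstock
      error, so disjoint bad intervals have total length at most \<open>e\<close>.\<close>
    obtain \<gamma> where "gauge \<gamma>" and
      \<gamma>: "\<And>p. \<lbrakk>p tagged_partial_division_of (cbox a b); \<gamma> fine p\<rbrakk> \<Longrightarrow>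
             sum (\<lambda>(x,k). norm(content k *\<^sub>R h x - integral k h)) p < e / Suc m"
      using Henstock_lemma[of h a b "e / Suc m"] h \<open>e > 0\<close> by auto
    \<comment> \<open>The closed ball about the midpoint of \<open>t\<close> and \<open>s\<close> is
      the interval between them. This turns intervals with the tag as an endpoint into balls, to
      which Vitali's covering theorem applies.\<close>
    define I where "I = {(t,s). t \<in> E m \<and> s \<in> {a..b} \<and> s \<noteq> t \<and> cball ((t+s)/2) (\<bar>s-t\<bar>/2) \<subseteq> \<gamma> t \<and> \<bar>s - t\<bar> < Suc m * R s t}"
    define B where "B = (\<lambda>(t,s::real). cball ((t+s)/2) (\<bar>s-t\<bar>/2))"
    have B_eq: "B (t,s) = {min t s..max t s}" for t s
      by (auto simp: B_def cball_eq_atLeastAtMost min_def max_def field_simps abs_if)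
    have cover: "\<exists>i. i \<in> I \<and> t \<in> cball ((\<lambda>(t,s). (t+s)/2) i) ((\<lambda>(t,s). \<bar>s-t\<bar>/2) i) \<and> (\<lambda>(t,s). \<bar>s-t\<bar>/2) i < d"
      if "t \<in> E m" "0 < d" for t d :: real
    proof -
      obtain r where "r > 0" and r: "ball t r \<subseteq> \<gamma> t"
        using \<open>gauge \<gamma>\<close> unfolding gauge_def by (meson openE)
      have "\<forall>d>0. \<exists>s\<in>{a..b}. s \<noteq> t \<and> \<bar>s - t\<bar> < d \<and> \<bar>s - t\<bar> < Suc m * R s t"
        using that(1) by (simp add: E_def)
      moreover have "min d r > 0"
        using that(2) \<open>r > 0\<close> by simp
      ultimately obtain s where s: "s \<in> {a..b}" "s \<noteq> t" "\<bar>s - t\<bar> < min d r" "\<bar>s - t\<bar> < Suc m * R s t"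
        by blast
      have "cball ((t+s)/2) (\<bar>s-t\<bar>/2) \<subseteq> ball t r"
        using B_eq[of t s] s by (auto simp: B_def dist_real_def)
      then have "(t, s) \<in> I"
        using that s r by (auto simp: I_def)
      moreover have "t \<in> cball ((t+s)/2) (\<bar>s-t\<bar>/2)"
        using B_eq[of t s] by (auto simp: B_def)
      ultimately show ?thesis
        using s by (intro exI[of _ "(t,s)"]) auto
    qed
    obtain C where C: "countable C" "C \<subseteq> I"
      "pairwise (\<lambda>i j. disjnt (B i) (B j)) C" "negligible (E m - (\<Union>i\<in>C. B i))"
      using Vitali_covering_theorem_cballs[where S="E m" and K=I and a="\<lambda>(t,s). (t+s)/2" and r="\<lambda>(t,s). \<bar>s-t\<bar>/2", OF _ cover]
      by (auto simp: B_def I_def split_def)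
    have meas: "B i \<in> lmeasurable" for i
      by (simp add: B_def split_def)
    \<comment> \<open>Henstock's lemma concerns finite families; the bound does not depend on
      \<open>J\<close>, so it passes to the countable union.\<close>
    have bound: "measure lebesgue (\<Union>i\<in>J. B i) \<le> e" if "J \<subseteq> C" "finite J" for J
    proof -
      define p where "p = (\<lambda>i. (fst i, B i)) ` J"
      have JI: "J \<subseteq> I" using that C by auto
      have fst_in: "fst i \<in> B i" for i
        by (cases i) (simp add: B_eq)
      have inj: "inj_on (\<lambda>i. (fst i, B i)) J"
        using C(3) that fst_in by (intro inj_onI) (metis disjnt_iff pairwiseD prod.inject subsetD)
      have "p tagged_partial_division_of cbox a b"
        unfolding tagged_partial_division_of_def
      proof (intro conjI allI impI)
        show "finite p" using that by (simp add: p_def)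
      next
        fix t K assume "(t, K) \<in> p"
        then obtain i where i: "i \<in> J" "t = fst i" "K = B i" by (auto simp: p_def)
        then show "t \<in> K" using fst_in by simp
        show "K \<subseteq> cbox a b"
          using i JI by (cases i) (auto simp: B_eq I_def E_def)
        show "\<exists>u v. K = cbox u v"
          using i by (cases i) (auto simp: B_eq)
      next
        fix t K t' K' assume "(t, K) \<in> p \<and> (t', K') \<in> p \<and> (t, K) \<noteq> (t', K')"
        then obtain i j where "i \<in> J" "j \<in> J" "i \<noteq> j" "K = B i" "K' = B j" by (auto simp: p_def)
        then have "disjnt K K'"
          using C(3) that by (auto simp: pairwise_def)
        then show "interior K \<inter> interior K' = {}"
          using interior_subset by (fastforce simp: disjnt_def)
      qed
      moreover have "\<gamma> fine p"
      proof -
        have "B i \<subseteq> \<gamma> (fst i)" if "i \<in> J" for i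
        proof -
          have "i \<in> I" using that JI by auto
          then show ?thesis unfolding I_def B_def by (cases i) simp
        qed
        then show ?thesis by (auto simp: fine_def p_def)
      qed
      ultimately have "sum (\<lambda>(x,k). norm(content k *\<^sub>R h x - integral k h)) p < e / Suc m"
        by (rule \<gamma>)
      then have "(\<Sum>i\<in>J. norm (content (B i) *\<^sub>R h (fst i) - integral (B i) h)) < e / Suc m"
        by (simp add: p_def sum.reindex[OF inj])
      then have "(\<Sum>i\<in>J. Suc m * norm (content (B i) *\<^sub>R h (fst i) - integral (B i) h)) < e"
        by (simp only: sum_distrib_left[symmetric]) (simp add: field_simps)
      moreover have "measure lebesgue (B i) \<le> Suc m * norm (content (B i) *\<^sub>R h (fst i) - integral (B i) h)"
        if "i \<in> J" for i
      proof -
        obtain t s where i: "i = (t, s)" by (cases i)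
        have ts: "t \<in> {a..b}" "s \<in> {a..b}" "\<bar>s - t\<bar> < Suc m * R s t"
          using that JI i by (auto simp: I_def E_def)
        have "R s t = norm (content (B i) *\<^sub>R h t - integral (B i) h)"
        proof (cases "t \<le> s")
          case True
          then show ?thesis
            using ts F_diff[of t s] by (simp add: R_def i B_eq norm_minus_commute)
        next
          case False
          then have "content (B i) *\<^sub>R h t - integral (B i) h = F s - F t - (s - t) *\<^sub>R h t"
            using ts F_diff[of s t] by (simp add: i B_eq algebra_simps)
          then show ?thesis by (simp add: R_def)
        qed
        moreover have "measure lebesgue (B i) = \<bar>s - t\<bar>"
          by (simp add: i B_eq min_def max_def)
        ultimately show ?thesis using ts i by simp
      qed
      ultimately have "(\<Sum>i\<in>J. measure lebesgue (B i)) \<le> e"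
        using sum_mono[of J "\<lambda>i. measure lebesgue (B i)"] by (smt (verit) sum_mono)
      moreover have "measure lebesgue (\<Union>i\<in>J. B i) \<le> (\<Sum>i\<in>J. measure lebesgue (B i))"
        using that meas by (intro measure_UNION_le) (auto simp: fmeasurableD)
      ultimately show ?thesis by simp
    qed
    have UC: "(\<Union>i\<in>C. B i) \<in> lmeasurable" "measure lebesgue (\<Union>i\<in>C. B i) \<le> e"
      using fmeasurable_UN_bound[OF C(1) meas bound] measure_UN_bound[OF C(1) meas bound] by auto
    let ?T = "(E m - (\<Union>i\<in>C. B i)) \<union> (\<Union>i\<in>C. B i)"
    have "?T \<in> lmeasurable"
      using UC C(4) by (intro fmeasurable.Un) (auto simp: negligible_imp_measurable)
    moreover have "measure lebesgue ?T \<le> e"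
    proof -
      have "measure lebesgue ?T \<le> measure lebesgue (E m - (\<Union>i\<in>C. B i)) + measure lebesgue (\<Union>i\<in>C. B i)"
        using UC C(4) by (intro measure_Un_le) (auto simp: negligible_imp_sets fmeasurableD)
      then show ?thesis
        using UC(2) negligible_imp_measure0[OF C(4)] by linarith
    qed
    ultimately show "\<exists>T. E m \<subseteq> T \<and> T \<in> lmeasurable \<and> measure lebesgue T \<le> e"
      by (intro exI[of _ ?T] conjI) auto
  qed
  then have "negligible (\<Union>m. E m)"
    by (intro negligible_countable_Union) auto
  moreover have "(F has_vector_derivative h t) (at t within {a..b})" if t: "t \<in> {a..b}" "t \<notin> (\<Union>m. E m)" for t
    unfolding has_vector_derivative_def has_derivative_within_alt
  proof (intro conjI allI impI)
    show "bounded_linear (\<lambda>x. x *\<^sub>R h t)"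
      by (rule bounded_linear_scaleR_left)
    fix e :: real assume "e > 0"
    obtain m where m: "1 / Suc m < e"
      using \<open>e > 0\<close> nat_approx_posE by blast
    obtain d where "d > 0" and d: "\<And>s. \<lbrakk>s \<in> {a..b}; s \<noteq> t; \<bar>s - t\<bar> < d\<rbrakk> \<Longrightarrow> Suc m * R s t \<le> \<bar>s - t\<bar>"
    proof -
      have "\<not> (\<forall>d>0. \<exists>s\<in>{a..b}. s \<noteq> t \<and> \<bar>s - t\<bar> < d \<and> \<bar>s - t\<bar> < Suc m * R s t)"
        using t by (simp add: E_def)
      then show thesis
        using that by (meson not_less)
    qed
    have "R s t \<le> e * norm (s - t)" if s: "s \<in> {a..b}" "norm (s - t) < d" for s
    proof (cases "s = t")
      case False
      then have "R s t \<le> 1 / Suc m * \<bar>s - t\<bar>"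
        using d[of s] s by (simp add: field_simps)
      also have "\<dots> \<le> e * \<bar>s - t\<bar>"
        using m by (intro mult_right_mono) auto
      finally show ?thesis by simp
    qed (simp add: R_def)
    then show "\<exists>d>0. \<forall>y\<in>{a..b}. norm (y - t) < d \<longrightarrow> norm (F y - F t - (y - t) *\<^sub>R h t) \<le> e * norm (y - t)"
      using \<open>d > 0\<close> unfolding R_def by blast
  qed
  ultimately show ?thesis
    unfolding F_def[symmetric]
    by (subst AE_lebesgue_on_iff_negligible) (auto elim!: negligible_subset)
qed

lemma lipschitz_imp_abs_continuous:
  fixes x :: "real \<Rightarrow> 'a::real_normed_vector"
  assumes "M-lipschitz_on {a..b} x"
  shows "abs_continuous_on {a..b} x"
  unfolding abs_continuous_on_def
proof (intro allI impI)
  fix e :: real assume "e > 0"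
  have "M \<ge> 0" using assms by (rule lipschitz_on_nonneg)
  show "\<exists>\<delta>>0. \<forall>d. d division_of \<Union>d \<and> \<Union>d \<subseteq> {a..b} \<and> (\<Sum>K\<in>d. Sup K - Inf K) < \<delta>
         \<longrightarrow> (\<Sum>K\<in>d. norm (x (Sup K) - x (Inf K))) < e"
  proof (intro exI conjI allI impI)
    \<comment> \<open>\<open>M + 1\<close> in place of \<open>M\<close> keeps the quotient positive
      for constant functions, where \<open>M\<close> may be zero.\<close>
    show "e / (M + 1) > 0" using \<open>e > 0\<close> \<open>M \<ge> 0\<close> by simp
    fix d assume d: "d division_of \<Union>d \<and> \<Union>d \<subseteq> {a..b} \<and> (\<Sum>K\<in>d. Sup K - Inf K) < e / (M + 1)"
    have K: "norm (x (Sup K) - x (Inf K)) \<le> M * (Sup K - Inf K) \<and> Inf K \<le> Sup K" if K: "K \<in> d" for K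
    proof -
      have div: "d division_of \<Union>d" using d by simp
      obtain u v where "K = {u..v}"
        using division_ofD(4)[OF div K] by auto
      moreover have "K \<noteq> {}" "K \<subseteq> {a..b}"
        using d division_ofD(2,3)[OF div K] by auto
      ultimately show ?thesis
        using lipschitz_onD[OF assms, of v u] by (auto simp: dist_norm)
    qed
    have "(\<Sum>K\<in>d. norm (x (Sup K) - x (Inf K))) \<le> (\<Sum>K\<in>d. M * (Sup K - Inf K))"
      by (intro sum_mono) (use K in auto)
    also have "\<dots> = M * (\<Sum>K\<in>d. Sup K - Inf K)"
      by (simp add: sum_distrib_left)
    also have "\<dots> \<le> (M + 1) * (\<Sum>K\<in>d. Sup K - Inf K)"
      using K by (intro mult_right_mono sum_nonneg) auto
    also have "\<dots> < e"
      using d \<open>M \<ge> 0\<close> by (simp add: field_simps)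
    finally show "(\<Sum>K\<in>d. norm (x (Sup K) - x (Inf K))) < e" .
  qed
qed

lemma abs_continuous_on_subset:
  assumes "abs_continuous_on S x" "T \<subseteq> S"
  shows "abs_continuous_on T x"
  using assms unfolding abs_continuous_on_def by (meson order_trans)

section \<open>Integral curves\<close>

text \<open>The Caratheodory solutions in integrated form, which is stable under limits, affine time
  changes and concatenation.\<close>

definition integral_curve :: "(real \<Rightarrow> 'a \<Rightarrow> 'a) \<Rightarrow> real \<Rightarrow> real \<Rightarrow> (real \<Rightarrow> 'a::real_normed_vector) \<Rightarrow> bool" where
  "integral_curve h a b x \<longleftrightarrow> (\<forall>t\<in>{a..b}. ((\<lambda>r. h r (x r)) has_integral (x t - x a)) {a..t})"

lemma integral_curve_continuous:
  fixes x :: "real \<Rightarrow> 'a::euclidean_space"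
  assumes "integral_curve h a b x"
  shows "continuous_on {a..b} x"
proof (cases "a \<le> b")
  case True
  then have "(\<lambda>r. h r (x r)) integrable_on {a..b}"
    using assms by (auto simp: integral_curve_def integrable_on_def)
  then have "continuous_on {a..b} (\<lambda>t. x a + integral {a..t} (\<lambda>r. h r (x r)))"
    by (intro continuous_intros indefinite_integral_continuous_1)
  moreover have "x a + integral {a..t} (\<lambda>r. h r (x r)) = x t" if "t \<in> {a..b}" for t
    using assms that unfolding integral_curve_def by (metis add.commute diff_add_cancel integral_unique)
  ultimately show ?thesis
    by (metis (no_types, lifting) continuous_on_cong)
qed simp

lemma integral_curve_has_integral:
  fixes x :: "real \<Rightarrow> 'a::euclidean_space"
  assumes "integral_curve h a b x" "a \<le> s" "s \<le> t" "t \<le> b"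
  shows "((\<lambda>r. h r (x r)) has_integral (x t - x s)) {s..t}"
proof -
  let ?h = "\<lambda>r. h r (x r)"
  have s: "(?h has_integral (x s - x a)) {a..s}" and t: "(?h has_integral (x t - x a)) {a..t}"
    using assms by (auto simp: integral_curve_def)
  have "?h integrable_on {a..t}"
    using t by (rule has_integral_integrable)
  then have "?h integrable_on {s..t}"
    using assms by (auto intro: integrable_subinterval_real[of ?h a t])
  then have "(?h has_integral (x s - x a + integral {s..t} ?h)) {a..t}"
    using assms by (intro has_integral_combine[OF _ _ s]) auto
  with t have "x t - x a = x s - x a + integral {s..t} ?h"
    by (rule has_integral_unique)
  with \<open>?h integrable_on {s..t}\<close> show ?thesis
    by (simp add: has_integral_iff)
qed

lemma integral_curve_subinterval:
  fixes x :: "real \<Rightarrow> 'a::euclidean_space"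
  assumes "integral_curve h a b x" "a \<le> c" "d \<le> b"
  shows "integral_curve h c d x"
  unfolding integral_curve_def using integral_curve_has_integral[OF assms(1)] assms by auto

text \<open>The left endpoint may be ignored in the right-hand sides: there a concatenated control
  carries the value of the preceding piece.\<close>

lemma integral_curve_cong:
  assumes "\<And>t. t \<in> {a<..b} \<Longrightarrow> h t (x t) = k t (y t)" "\<And>t. t \<in> {a..b} \<Longrightarrow> x t = y t"
  shows "integral_curve h a b x \<longleftrightarrow> integral_curve k a b y"
  unfolding integral_curve_def
proof (intro ball_cong refl)
  fix t assume t: "t \<in> {a..b}"
  have "((\<lambda>r. h r (x r)) has_integral y t - y a) {a..t} = ((\<lambda>r. k r (y r)) has_integral y t - y a) {a..t}"
    by (rule has_integral_spike_eq[of "{a}"]) (use t assms(1) in auto)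
  then show "((\<lambda>r. h r (x r)) has_integral x t - x a) {a..t} = ((\<lambda>r. k r (y r)) has_integral y t - y a) {a..t}"
    using t assms(2)[of t] assms(2)[of a] by simp
qed

lemma integral_curve_lipschitz:
  fixes x :: "real \<Rightarrow> 'a::euclidean_space"
  assumes x: "integral_curve h a b x" and M: "\<And>t. t \<in> {a..b} \<Longrightarrow> norm (h t (x t)) \<le> M" "0 \<le> M"
  shows "M-lipschitz_on {a..b} x"
proof (rule lipschitz_onI)
  have *: "norm (x t - x s) \<le> M * (t - s)" if "a \<le> s" "s \<le> t" "t \<le> b" for s t
    using has_integral_bound[OF M(2), of "\<lambda>r. h r (x r)" "x t - x s" s t]
      integral_curve_has_integral[OF x that] M(1) that by auto
  fix s t assume "s \<in> {a..b}" "t \<in> {a..b}"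
  then show "dist (x s) (x t) \<le> M * dist s t"
    using *[of s t] *[of t s] by (cases "s \<le> t") (auto simp: dist_norm norm_minus_commute)
qed fact

lemma ode_solution_imp_integral_curve:
  fixes x :: "real \<Rightarrow> 'a::euclidean_space"
  assumes "ode_solution h a b x"
  shows "integral_curve h a b x"
  unfolding integral_curve_def
proof
  fix t assume t: "t \<in> {a..b}"
  define N where "N = {t\<in>{a..b}. \<not> (x has_vector_derivative h t (x t)) (at t within {a..b})}"
  have "negligible N"
    using assms unfolding ode_solution_def N_def by (simp add: AE_lebesgue_on_iff_negligible)
  moreover have "abs_continuous_on {a..t} x"
    using assms t unfolding ode_solution_def by (auto intro: abs_continuous_on_subset)
  moreover have "(x has_vector_derivative h r (x r)) (at r within {a..t})" if "r \<in> {a..t} - N" for r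
    using that t by (auto intro: has_vector_derivative_within_subset[of x _ r "{a..b}"] simp: N_def)
  ultimately show "((\<lambda>r. h r (x r)) has_integral (x t - x a)) {a..t}"
    using t by (intro abs_continuous_has_integral[where N=N]) auto
qed

text \<open>The local bound on \<open>h\<close> makes an integral curve Lipschitz, since its image
  is compact, and hence absolutely continuous; a general gauge primitive need not be. The a.e.
  derivative is that of the indefinite integral.\<close>

lemma ode_solution_iff_integral_curve:
  fixes x :: "real \<Rightarrow> 'a::euclidean_space"
  assumes bdd: "\<And>R. \<exists>M. \<forall>t\<in>{a..b}. \<forall>z. norm z \<le> R \<longrightarrow> norm (h t z) \<le> M"
  shows "ode_solution h a b x \<longleftrightarrow> integral_curve h a b x"
proof
  assume x: "integral_curve h a b x"
  show "ode_solution h a b x"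
    unfolding ode_solution_def
  proof
    have "compact (x ` {a..b})"
      using integral_curve_continuous[OF x] by (intro compact_continuous_image) auto
    then obtain R where R: "\<And>t. t \<in> {a..b} \<Longrightarrow> norm (x t) \<le> R"
      by (metis compact_imp_bounded bounded_iff imageI)
    obtain M where M: "\<forall>t\<in>{a..b}. \<forall>z. norm z \<le> R \<longrightarrow> norm (h t z) \<le> M"
      using bdd by blast
    have "(max M 0)-lipschitz_on {a..b} x"
      using M R by (intro integral_curve_lipschitz[OF x]) (auto simp: max.coboundedI1)
    then show "abs_continuous_on {a..b} x"
      by (rule lipschitz_imp_abs_continuous)
    show "AE t in lebesgue_on {a..b}. (x has_vector_derivative h t (x t)) (at t within {a..b})"
    proof (cases "a \<le> b")
      case True
      let ?F = "\<lambda>s. integral {a..s} (\<lambda>r. h r (x r))"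
      have "(\<lambda>r. h r (x r)) integrable_on {a..b}"
        using x True by (auto simp: integral_curve_def integrable_on_def)
      then have "AE t in lebesgue_on {a..b}. (?F has_vector_derivative h t (x t)) (at t within {a..b})"
        by (rule AE_has_vector_derivative_indefinite_integral)
      then show ?thesis
      proof (rule AE_mp, intro AE_I2 impI)
        fix t assume t: "t \<in> space (lebesgue_on {a..b})"
          and F: "(?F has_vector_derivative h t (x t)) (at t within {a..b})"
        have deriv: "((\<lambda>s. x a + ?F s) has_vector_derivative h t (x t)) (at t within {a..b})"
          using has_vector_derivative_add[OF has_vector_derivative_const F] by simp
        have eq: "x s = x a + ?F s" if "s \<in> {a..b}" for s
          using x that unfolding integral_curve_def by (simp add: has_integral_iff)
        have "t \<in> {a..b}" using t by simp
        then show "(x has_vector_derivative h t (x t)) (at t within {a..b})"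
          using eq deriv by (rule has_vector_derivative_transform)
      qed
    qed (simp add: AE_lebesgue_on_iff_negligible)
  qed
qed (rule ode_solution_imp_integral_curve)

text \<open>Substitution in the integral. The factor \<open>c\<close> is the speed of the time
  change; this is where the factors \<xi> and \<open>T - \<xi>\<close> in the dynamics of (P) come
  from.\<close>

lemma integral_curve_affine:
  fixes x :: "real \<Rightarrow> 'a::euclidean_space"
  assumes x: "integral_curve h a b x" and c: "c > 0"
  shows "integral_curve (\<lambda>s z. c *\<^sub>R h (c * s + p) z) ((a - p) / c) ((b - p) / c) (\<lambda>s. x (c * s + p))"
  unfolding integral_curve_def
proof
  fix t assume t: "t \<in> {(a - p) / c..(b - p) / c}"
  then have "c * t + p \<in> {a..b}"
    using c by (simp add: field_simps)
  then have "((\<lambda>r. h r (x r)) has_integral (x (c * t + p) - x a)) (cbox a (c * t + p))"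
    using x by (simp add: integral_curve_def)
  from has_integral_affinity'[OF this c, of p]
  have "((\<lambda>s. h (c * s + p) (x (c * s + p))) has_integral (x (c * t + p) - x a) /\<^sub>R c) {(a - p) / c..t}"
    using c by (simp add: field_simps)
  from has_integral_cmul[OF this, of c]
  show "((\<lambda>s. c *\<^sub>R h (c * s + p) (x (c * s + p))) has_integral x (c * t + p) - x (c * ((a - p) / c) + p)) {(a - p) / c..t}"
    using c by simp
qed

lemma integral_curve_append:
  fixes x :: "real \<Rightarrow> 'a::euclidean_space"
  assumes "integral_curve h a c x" "integral_curve h c b x" "a \<le> c" "c \<le> b"
  shows "integral_curve h a b x"
  unfolding integral_curve_def
proof
  fix t assume t: "t \<in> {a..b}"
  let ?h = "\<lambda>r. h r (x r)"
  show "(?h has_integral (x t - x a)) {a..t}"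
  proof (cases "t \<le> c")
    case True
    then show ?thesis using assms t by (simp add: integral_curve_def)
  next
    case False
    have "(?h has_integral (x c - x a) + (x t - x c)) {a..t}"
      by (rule has_integral_combine[of a c t]) (use assms t False in \<open>auto simp: integral_curve_def\<close>)
    then show ?thesis by simp
  qed
qed

text \<open>Instead of Gronwall's inequality: maximise \<open>norm (x t)\<close> against the weight
  \<open>exp (2 * c1 * (t - a))\<close>.\<close>

lemma integral_curve_norm_bound:
  fixes x :: "real \<Rightarrow> 'a::euclidean_space"
  assumes x: "integral_curve h a b x" and "c1 > 0" "c2 \<ge> 0"
    and growth: "\<And>t. t \<in> {a..b} \<Longrightarrow> norm (h t (x t)) \<le> c1 * norm (x t) + c2"
    and t: "t \<in> {a..b}"
  shows "norm (x t) \<le> 2 * (norm (x a) + c2 * (b - a)) * exp (2 * c1 * (b - a))"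
proof -
  define A where "A = norm (x a) + c2 * (b - a)"
  define w where "w s = exp (2 * c1 * (s - a))" for s
  define m where "m s = norm (x s) / w s" for s
  have w_pos: "w s > 0" for s by (simp add: w_def)
  have [simp]: "A \<ge> 0" using t \<open>c2 \<ge> 0\<close> by (simp add: A_def)
  have "continuous_on {a..b} m"
    unfolding m_def w_def by (intro continuous_intros integral_curve_continuous[OF x]) auto
  moreover have "compact {a..b}" "{a..b} \<noteq> {}"
    using t by auto
  ultimately obtain s where s: "s \<in> {a..b}" and max: "\<And>r. r \<in> {a..b} \<Longrightarrow> m r \<le> m s"
    using continuous_attains_sup[of "{a..b}" m] by blast
  have x_le: "norm (x r) \<le> m s * w r" if "r \<in> {a..b}" for r
    using max[OF that] w_pos[of r] by (simp add: m_def field_simps)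
  have w_int: "((\<lambda>r. w r) has_integral (w s / (2 * c1) - w a / (2 * c1))) {a..s}"
  proof (rule fundamental_theorem_of_calculus)
    fix r assume "r \<in> {a..s}"
    show "((\<lambda>s. w s / (2 * c1)) has_vector_derivative w r) (at r within {a..s})"
      unfolding w_def has_real_derivative_iff_has_vector_derivative[symmetric]
      by (rule derivative_eq_intros refl | use \<open>c1 > 0\<close> in simp)+
  qed (use s in auto)
  have x_int: "((\<lambda>r. h r (x r)) has_integral (x s - x a)) {a..s}"
    using x s by (simp add: integral_curve_def)
  \<comment> \<open>The rate \<open>2 * c1\<close> of the weight is twice the growth rate, so the
    first term integrates to half of \<open>m s * (w s - w a)\<close>. It can then be absorbed into
    \<open>norm (x s)\<close>, which is \<open>m s * w s\<close>.\<close>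
  have "((\<lambda>r. c1 * (m s * w r) + c2) has_integral c1 * (m s * (w s / (2 * c1) - w a / (2 * c1))) + c2 * (s - a)) {a..s}"
    using s has_integral_const_real[of c2 a s]
    by (intro has_integral_add has_integral_mult_right w_int) (simp add: mult.commute)
  moreover have "norm (h r (x r)) \<le> c1 * (m s * w r) + c2" if "r \<in> {a..s}" for r
  proof -
    have "r \<in> {a..b}" using that s by auto
    then have "c1 * norm (x r) \<le> c1 * (m s * w r)" "norm (h r (x r)) \<le> c1 * norm (x r) + c2"
      using \<open>c1 > 0\<close> by (auto intro!: mult_left_mono x_le growth)
    then show ?thesis by linarith
  qed
  ultimately have "norm (integral {a..s} (\<lambda>r. h r (x r))) \<le> c1 * (m s * (w s / (2 * c1) - w a / (2 * c1))) + c2 * (s - a)"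
    using x_int by (metis (no_types, lifting) has_integral_integrable_integral integral_norm_bound_integral)
  moreover have "c1 * (m s * (w s / (2 * c1) - w a / (2 * c1))) = m s * (w s - w a) / 2"
    using \<open>c1 > 0\<close> by (simp add: field_simps)
  ultimately have "norm (x s - x a) \<le> m s * (w s - w a) / 2 + c2 * (s - a)"
    using x_int by (simp add: has_integral_iff)
  moreover have "norm (x s) \<le> norm (x a) + norm (x s - x a)"
    by (metis norm_triangle_sub)
  moreover have "c2 * (s - a) \<le> c2 * (b - a)"
    using s \<open>c2 \<ge> 0\<close> by (intro mult_left_mono) auto
  moreover have "m s * w a \<ge> 0"
    using w_pos by (simp add: m_def less_imp_le)
  ultimately have "norm (x s) \<le> A + m s * w s / 2"
    by (simp add: A_def algebra_simps diff_divide_distrib)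
  moreover have "norm (x s) = m s * w s"
    using w_pos[of s] by (simp add: m_def)
  ultimately have "m s * w s \<le> 2 * A"
    by simp
  moreover have "w s \<ge> 1"
    using s \<open>c1 > 0\<close> by (simp add: w_def)
  moreover have "m s \<ge> 0"
    using w_pos[of s] by (simp add: m_def)
  ultimately have "m s \<le> 2 * A"
    using mult_left_mono[of 1 "w s" "m s"] by simp
  then have "norm (x t) \<le> 2 * A * w t"
    using order_trans[OF x_le[OF t] mult_right_mono] w_pos[of t] by (simp add: less_imp_le)
  also have "\<dots> \<le> 2 * A * w b"
    using t \<open>c1 > 0\<close> by (intro mult_left_mono) (auto simp: w_def)
  finally show ?thesis
    by (simp add: A_def w_def)
qed

text \<open>Dominated convergence with a constant majorant. Setting all functions to zero on
  \<open>N\<close> turns the a.e. limit into an everywhere one; this is needed for controls that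
  converge only almost everywhere.\<close>

lemma has_integral_bounded_limit:
  fixes F :: "nat \<Rightarrow> real \<Rightarrow> 'a::euclidean_space"
  assumes F: "\<And>k. (F k has_integral i k) {a..b}" and M: "\<And>k t. t \<in> {a..b} \<Longrightarrow> norm (F k t) \<le> M"
    and N: "negligible N" and lim: "\<And>t. t \<in> {a..b} - N \<Longrightarrow> (\<lambda>k. F k t) \<longlonglongrightarrow> G t"
    and i: "i \<longlonglongrightarrow> j"
  shows "(G has_integral j) {a..b}"
proof -
  let ?F = "\<lambda>k t. if t \<in> N then 0 else F k t" and ?G = "\<lambda>t. if t \<in> N then 0 else G t"
  have F': "(?F k has_integral i k) {a..b}" for k
    by (rule has_integral_spike[OF N _ F[of k]]) auto
  have 1: "?F k integrable_on {a..b}" for k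
    using F' by blast
  have 2: "(\<lambda>_. \<bar>M\<bar>) integrable_on {a..b}"
    by (rule integrable_const_ivl)
  have 3: "norm (?F k t) \<le> \<bar>M\<bar>" if "t \<in> {a..b}" for k t
    using M[OF that, of k] by auto
  have 4: "(\<lambda>k. ?F k t) \<longlonglongrightarrow> ?G t" if "t \<in> {a..b}" for t
    using lim that by auto
  have "?G integrable_on {a..b}" "(\<lambda>k. integral {a..b} (?F k)) \<longlonglongrightarrow> integral {a..b} ?G"
    using dominated_convergence[OF 1 2 3 4] by auto
  moreover have "integral {a..b} (?F k) = i k" for k
    using F' by (rule integral_unique)
  ultimately have "(?G has_integral j) {a..b}"
    using i LIMSEQ_unique by (auto simp: has_integral_iff)
  then show ?thesis
    by (rule has_integral_spike[OF N, rotated]) auto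
qed

lemma has_integral_Pair_iff:
  "((\<lambda>r. (p r, q r)) has_integral (i, j)) S \<longleftrightarrow> (p has_integral i) S \<and> (q has_integral j) S"
  for p :: "'c::euclidean_space \<Rightarrow> 'a::real_normed_vector" and q :: "'c \<Rightarrow> 'b::real_normed_vector"
proof
  assume *: "((\<lambda>r. (p r, q r)) has_integral (i, j)) S"
  show "(p has_integral i) S \<and> (q has_integral j) S"
    using has_integral_linear[OF * bounded_linear_fst] has_integral_linear[OF * bounded_linear_snd]
    by (simp add: o_def)
next
  assume *: "(p has_integral i) S \<and> (q has_integral j) S"
  have "bounded_linear (\<lambda>x. (x, 0))" "bounded_linear (\<lambda>x. (0, x))"
    by (auto intro!: bounded_linear_intros)
  with * have "((\<lambda>r. (p r, 0)) has_integral (i, 0)) S" "((\<lambda>r. (0, q r)) has_integral (0, j)) S"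
    using has_integral_linear[of p i S "\<lambda>x. (x, 0)"] has_integral_linear[of q j S "\<lambda>x. (0, x)"]
    by (auto simp: o_def)
  from has_integral_add[OF this] show "((\<lambda>r. (p r, q r)) has_integral (i, j)) S"
    by simp
qed

section \<open>Passage between the time crisis problem and (P)\<close>

lemma is_trajectory_iff_integral_curve:
  fixes f :: "real^'n \<Rightarrow> real^'m \<Rightarrow> real^'n"
  assumes growth: "\<forall>x. \<forall>u\<in>U. norm (f x u) \<le> c1 * norm x + c2" and "c1 > 0"
    and u: "u \<in> controls 0 T U"
  shows "is_trajectory f x0 T u x \<longleftrightarrow>
    x \<in> extensional {0..T} \<and> integral_curve (\<lambda>t z. f z (u t)) 0 T x \<and> x 0 = x0"
proof -
  have "ode_solution (\<lambda>t z. f z (u t)) 0 T x \<longleftrightarrow> integral_curve (\<lambda>t z. f z (u t)) 0 T x"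
  proof (rule ode_solution_iff_integral_curve, intro exI ballI allI impI)
    fix R t :: real and z :: "real^'n" assume t: "t \<in> {0..T}" and z: "norm z \<le> R"
    have "norm (f z (u t)) \<le> c1 * norm z + c2"
      using growth u t by (auto simp: controls_def)
    also have "\<dots> \<le> c1 * R + c2"
      using z \<open>c1 > 0\<close> by simp
    finally show "norm (f z (u t)) \<le> c1 * R + c2" .
  qed
  then show ?thesis
    by (simp add: is_trajectory_def)
qed

lemma P_trajectories_iff_integral_curve:
  fixes f :: "real^'n \<Rightarrow> real^'m \<Rightarrow> real^'n"
  assumes growth: "\<forall>x. \<forall>u\<in>U. norm (f x u) \<le> c1 * norm x + c2" and "c1 > 0"
    and v: "v \<in> controls 0 1 (U \<times> U)"
  shows "(y, v) \<in> P_trajectories f T U \<longleftrightarrow> integral_curve (\<lambda>s z. P_dynamics f T z (v s)) 0 1 y"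
proof -
  have "ode_solution (\<lambda>s z. P_dynamics f T z (v s)) 0 1 y \<longleftrightarrow> integral_curve (\<lambda>s z. P_dynamics f T z (v s)) 0 1 y"
  proof (rule ode_solution_iff_integral_curve, intro exI ballI allI impI)
    fix R s :: real and z :: "(real^'n) \<times> (real^'n) \<times> real"
    assume s: "s \<in> {0..1}" and "norm z \<le> R"
    obtain y1 y2 \<xi> where z: "z = (y1, y2, \<xi>)" by (cases z)
    obtain v1 v2 where vs: "v s = (v1, v2)" by (cases "v s")
    have "norm y1 \<le> R" "norm y2 \<le> R" "\<bar>\<xi>\<bar> \<le> R"
      using \<open>norm z \<le> R\<close> norm_fst_le[of y1 "(y2, \<xi>)"] norm_snd_le[of "(y2, \<xi>)" y1]
        norm_fst_le[of y2 \<xi>] norm_snd_le[of \<xi> y2] by (auto simp: z)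
    moreover have "v1 \<in> U" "v2 \<in> U"
      using v s vs by (auto simp: controls_def dest!: bspec)
    ultimately have f: "norm (f y1 v1) \<le> c1 * R + c2" "norm (f y2 v2) \<le> c1 * R + c2"
      using growth \<open>c1 > 0\<close> by (smt (verit) mult_left_mono)+
    have "norm (P_dynamics f T z (v s)) \<le> norm (\<xi> *\<^sub>R f y1 v1) + norm ((T - \<xi>) *\<^sub>R f y2 v2)"
      using norm_Pair_le[of "\<xi> *\<^sub>R f y1 v1" "((T - \<xi>) *\<^sub>R f y2 v2, 0::real)"]
      by (simp add: P_dynamics_def z vs)
    also have "\<dots> \<le> R * (c1 * R + c2) + (\<bar>T\<bar> + R) * (c1 * R + c2)"
      unfolding norm_scaleR using f \<open>\<bar>\<xi>\<bar> \<le> R\<close> by (intro add_mono mult_mono) auto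
    finally show "norm (P_dynamics f T z (v s)) \<le> R * (c1 * R + c2) + (\<bar>T\<bar> + R) * (c1 * R + c2)" .
  qed
  then show ?thesis
    using v by (simp add: P_trajectories_def)
qed

text \<open>The third equation has zero right-hand side and freezes \<xi>; with \<xi> constant the
  system decouples into one curve for each half of the control.\<close>

lemma integral_curve_P_dynamics_iff:
  fixes f :: "real^'n \<Rightarrow> real^'m \<Rightarrow> real^'n"
  shows "integral_curve (\<lambda>s z. P_dynamics f T z (v s)) 0 1 y \<longleftrightarrow>
    (\<exists>\<xi>. (\<forall>s\<in>{0..1}. snd (snd (y s)) = \<xi>) \<and>
      integral_curve (\<lambda>s z. \<xi> *\<^sub>R f z (fst (v s))) 0 1 (\<lambda>s. fst (y s)) \<and>
      integral_curve (\<lambda>s z. (T - \<xi>) *\<^sub>R f z (snd (v s))) 0 1 (\<lambda>s. fst (snd (y s))))"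
    (is "?L \<longleftrightarrow> (\<exists>\<xi>. ?const \<xi> \<and> ?R1 \<xi> \<and> ?R2 \<xi>)")
proof -
  have P: "P_dynamics f T (y r) (v r) = (snd (snd (y r)) *\<^sub>R f (fst (y r)) (fst (v r)),
      (T - snd (snd (y r))) *\<^sub>R f (fst (snd (y r))) (snd (v r)), 0)" for r
    by (simp add: P_dynamics_def split_def)
  have *: "y t - y 0 = (fst (y t) - fst (y 0), fst (snd (y t)) - fst (snd (y 0)), snd (snd (y t)) - snd (snd (y 0)))" for t
    by (simp add: prod_eq_iff)
  have L: "?L \<longleftrightarrow> (\<forall>t\<in>{0..1}.
      ((\<lambda>r. snd (snd (y r)) *\<^sub>R f (fst (y r)) (fst (v r))) has_integral fst (y t) - fst (y 0)) {0..t} \<and>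
      ((\<lambda>r. (T - snd (snd (y r))) *\<^sub>R f (fst (snd (y r))) (snd (v r))) has_integral fst (snd (y t)) - fst (snd (y 0))) {0..t} \<and>
      ((\<lambda>r. 0) has_integral snd (snd (y t)) - snd (snd (y 0))) {0..t})"
    unfolding integral_curve_def P * has_integral_Pair_iff ..
  have const: "?const (snd (snd (y 0)))" if ?L
  proof
    fix t :: real assume "t \<in> {0..1}"
    then have "((\<lambda>r. 0) has_integral snd (snd (y t)) - snd (snd (y 0))) {0..t}"
      using that L by blast
    then show "snd (snd (y t)) = snd (snd (y 0))"
      using has_integral_0 has_integral_unique by fastforce
  qed
  have eq: "?L \<longleftrightarrow> ?R1 \<xi> \<and> ?R2 \<xi>" if c: "?const \<xi>" for \<xi>
  proof -
    have e: "((\<lambda>r. snd (snd (y r)) *\<^sub>R f (fst (y r)) (fst (v r))) has_integral fst (y t) - fst (y 0)) {0..t} \<longleftrightarrow>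
       ((\<lambda>r. \<xi> *\<^sub>R f (fst (y r)) (fst (v r))) has_integral fst (y t) - fst (y 0)) {0..t}"
      "((\<lambda>r. (T - snd (snd (y r))) *\<^sub>R f (fst (snd (y r))) (snd (v r))) has_integral fst (snd (y t)) - fst (snd (y 0))) {0..t} \<longleftrightarrow>
       ((\<lambda>r. (T - \<xi>) *\<^sub>R f (fst (snd (y r))) (snd (v r))) has_integral fst (snd (y t)) - fst (snd (y 0))) {0..t}"
      "((\<lambda>r. 0) has_integral snd (snd (y t)) - snd (snd (y 0))) {0..t}"
      if "t \<in> {0..1}" for t
      using that c by (auto intro!: has_integral_cong)
    show ?thesis
      unfolding L integral_curve_def[of "\<lambda>s z. \<xi> *\<^sub>R f z (fst (v s))"]
        integral_curve_def[of "\<lambda>s z. (T - \<xi>) *\<^sub>R f z (snd (v s))"] ball_conj_distrib[symmetric]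
      by (intro ball_cong refl) (simp only: e simp_thms)
  qed
  show ?thesis
    using const eq by blast
qed

section \<open>Gluing the two halves of a pair of (P)\<close>

text \<open>The function on \<open>[0,T]\<close> whose composition with \<open>time_change T \<xi>\<close> is \<open>p\<close> on \<open>[0,1]\<close> and
  \<open>\<lambda>s. q (s - 1)\<close> on \<open>(1,2]\<close>.\<close>

definition glue :: "real \<Rightarrow> real \<Rightarrow> (real \<Rightarrow> 'a) \<Rightarrow> (real \<Rightarrow> 'a) \<Rightarrow> real \<Rightarrow> 'a" where
  "glue T \<xi> p q t = (if t \<le> \<xi> then p (t / \<xi>) else q ((t - \<xi>) / (T - \<xi>)))"

lemma glue_first: "0 < \<xi> \<Longrightarrow> s \<le> 1 \<Longrightarrow> glue T \<xi> p q (\<xi> * s) = p s"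
  by (simp add: glue_def)

lemma glue_second: "\<xi> < T \<Longrightarrow> 0 < s \<Longrightarrow> glue T \<xi> p q ((T - \<xi>) * s + \<xi>) = q s"
  by (simp add: glue_def mult_le_0_iff)

text \<open>Undoing the two time scalings cancels the factors \<xi> and \<open>T - \<xi>\<close>,
  and \<open>q 0 = p 1\<close> makes the pieces fit. At the joint \<open>glue\<close> takes the
  control value of the first piece, which is harmless because \<open>integral_curve_cong\<close>
  ignores the left endpoint.\<close>

lemma integral_curve_glue:
  fixes f :: "'a::euclidean_space \<Rightarrow> 'b \<Rightarrow> 'a"
  assumes \<xi>: "0 < \<xi>" "\<xi> < T"
    and p: "integral_curve (\<lambda>s z. \<xi> *\<^sub>R f z (v s)) 0 1 p"
    and q: "integral_curve (\<lambda>s z. (T - \<xi>) *\<^sub>R f z (w s)) 0 1 q"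
    and pq: "q 0 = p 1"
  shows "integral_curve (\<lambda>t z. f z (glue T \<xi> v w t)) 0 T (glue T \<xi> p q)"
proof (rule integral_curve_append)
  have "integral_curve (\<lambda>s z. (1/\<xi>) *\<^sub>R \<xi> *\<^sub>R f z (v (1/\<xi> * s + 0))) ((0 - 0) / (1/\<xi>)) ((1 - 0) / (1/\<xi>)) (\<lambda>s. p (1/\<xi> * s + 0))"
    using \<xi> by (intro integral_curve_affine[OF p]) simp
  then have "integral_curve (\<lambda>s z. f z (v (s/\<xi>))) 0 \<xi> (\<lambda>s. p (s/\<xi>))"
    using \<xi> by simp
  then show "integral_curve (\<lambda>t z. f z (glue T \<xi> v w t)) 0 \<xi> (glue T \<xi> p q)"
    by (rule integral_curve_cong[THEN iffD1, rotated 2]) (auto simp: glue_def)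
  \<comment> \<open>Coefficients of the inverse of the map from \<open>s\<close> to
    \<open>(T - \<xi>) * s + \<xi>\<close>.\<close>
  define c d where "c = 1 / (T - \<xi>)" and "d = - \<xi> / (T - \<xi>)"
  have "c > 0" using \<xi> by (simp add: c_def)
  have cd: "(0 - d) / c = \<xi>" "(1 - d) / c = T" "c * s + d = (s - \<xi>) / (T - \<xi>)" for s
    using \<xi> by (simp_all add: c_def d_def diff_divide_distrib) (simp add: field_simps)
  have [simp]: "c * (T - \<xi>) = 1"
    using \<xi> by (simp add: c_def)
  have "integral_curve (\<lambda>s z. f z (w ((s - \<xi>) / (T - \<xi>)))) \<xi> T (\<lambda>s. q ((s - \<xi>) / (T - \<xi>)))"
    using integral_curve_affine[OF q \<open>c > 0\<close>, of d] unfolding cd by simp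
  then show "integral_curve (\<lambda>t z. f z (glue T \<xi> v w t)) \<xi> T (glue T \<xi> p q)"
    by (rule integral_curve_cong[THEN iffD1, rotated 2]) (use \<xi> pq in \<open>auto simp: glue_def\<close>)
qed (use \<xi> in auto)

text \<open>Lebesgue measurability is not stable under composition with arbitrary continuous maps;
  it is under affine maps with \<open>c \<noteq> 0\<close>, which pull null sets back to null
  sets.\<close>

lemma borel_measurable_lebesgue_on_affine:
  fixes w :: "real \<Rightarrow> 'a::topological_space"
  assumes "w \<in> borel_measurable (lebesgue_on B)" "c \<noteq> 0" "\<And>t. t \<in> A \<Longrightarrow> c * t + p \<in> B"
  shows "(\<lambda>t. w (c * t + p)) \<in> borel_measurable (lebesgue_on A)"
proof -
  have "(\<lambda>t. p + c * t) \<in> lebesgue \<rightarrow>\<^sub>M lebesgue"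
    using lebesgue_affine_measurable[where c= "\<lambda>x::real. c"] \<open>c \<noteq> 0\<close> by simp
  then have "(\<lambda>t. c * t + p) \<in> lebesgue_on A \<rightarrow>\<^sub>M lebesgue_on B"
    using assms(3) by (intro measurable_restrict_space3) (auto simp: add.commute)
  from measurable_compose[OF this assms(1)] show ?thesis .
qed

lemma glue_controls:
  fixes v w :: "real \<Rightarrow> 'a::euclidean_space"
  assumes \<xi>: "0 < \<xi>" "\<xi> < T" and v: "v \<in> controls 0 1 U" and w: "w \<in> controls 0 1 U"
  shows "glue T \<xi> v w \<in> controls 0 T U"
proof -
  have "(\<lambda>t. v (1/\<xi> * t + 0)) \<in> borel_measurable (lebesgue_on ({0..T} \<inter> {t. t \<le> \<xi>}))"
    using v \<xi> by (intro borel_measurable_lebesgue_on_affine[where B="{0..1}"]) (auto simp: controls_def)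
  moreover have "1/(T - \<xi>) * t + (- \<xi> / (T - \<xi>)) = (t - \<xi>) / (T - \<xi>)" for t
    by (simp add: diff_divide_distrib)
  then have "(\<lambda>t. w (1/(T - \<xi>) * t + (- \<xi> / (T - \<xi>)))) \<in> borel_measurable (lebesgue_on ({0..T} \<inter> {t. \<not> t \<le> \<xi>}))"
    using w \<xi> by (intro borel_measurable_lebesgue_on_affine[where B="{0..1}"]) (auto simp: controls_def)
  ultimately have "(\<lambda>t. if t \<le> \<xi> then v (t / \<xi>) else w ((t - \<xi>) / (T - \<xi>))) \<in> borel_measurable (lebesgue_on {0..T})"
    by (subst measurable_If_restrict_space_iff)
      (auto simp: restrict_restrict_space diff_divide_distrib sets_restrict_space_iff)
  moreover have "glue T \<xi> v w t \<in> U" if "t \<in> {0..T}" for t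
    using that v w \<xi> by (auto simp: glue_def controls_def)
  ultimately show ?thesis
    by (simp add: controls_def glue_def[abs_def])
qed

text \<open>The passage from (P) to the original dynamics. The hypotheses on \<xi> and
  \<open>join\<close> are what the endpoint constraint provides.\<close>

lemma P_trajectories_glue:
  fixes f :: "real^'n \<Rightarrow> real^'m \<Rightarrow> real^'n"
  assumes growth: "\<forall>x. \<forall>u\<in>U. norm (f x u) \<le> c1 * norm x + c2" and "c1 > 0"
    and P: "(y, v) \<in> P_trajectories f T U"
    and \<xi>: "\<xi> = snd (snd (y 0))" "0 < \<xi>" "\<xi> < T"
    and join: "fst (snd (y 0)) = fst (y 1)"
  shows "glue T \<xi> (\<lambda>s. fst (v s)) (\<lambda>s. snd (v s)) \<in> controls 0 T U"
    and "integral_curve (\<lambda>s z. \<xi> *\<^sub>R f z (fst (v s))) 0 1 (\<lambda>s. fst (y s))"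
    and "integral_curve (\<lambda>s z. (T - \<xi>) *\<^sub>R f z (snd (v s))) 0 1 (\<lambda>s. fst (snd (y s)))"
    and "integral_curve (\<lambda>t z. f z (glue T \<xi> (\<lambda>s. fst (v s)) (\<lambda>s. snd (v s)) t)) 0 T
          (glue T \<xi> (\<lambda>s. fst (y s)) (\<lambda>s. fst (snd (y s))))"
proof -
  have v: "v \<in> controls 0 1 (U \<times> U)"
    using P by (simp add: P_trajectories_def)
  then have v_meas: "v \<in> borel_measurable (lebesgue_on {0..1})"
    by (simp add: controls_def)
  have "(\<lambda>s. fst (v s)) \<in> borel_measurable (lebesgue_on {0..1})"
    by (rule measurable_compose[OF v_meas borel_measurable_continuous_onI]) (intro continuous_intros)
  moreover have "(\<lambda>s. snd (v s)) \<in> borel_measurable (lebesgue_on {0..1})"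
    by (rule measurable_compose[OF v_meas borel_measurable_continuous_onI]) (intro continuous_intros)
  ultimately have "(\<lambda>s. fst (v s)) \<in> controls 0 1 U" "(\<lambda>s. snd (v s)) \<in> controls 0 1 U"
    using v by (auto simp: controls_def mem_Times_iff)
  then show "glue T \<xi> (\<lambda>s. fst (v s)) (\<lambda>s. snd (v s)) \<in> controls 0 T U"
    using \<xi> by (intro glue_controls)
  have "integral_curve (\<lambda>s z. P_dynamics f T z (v s)) 0 1 y"
    using P P_trajectories_iff_integral_curve[OF growth \<open>c1 > 0\<close> v] by simp
  then show 1: "integral_curve (\<lambda>s z. \<xi> *\<^sub>R f z (fst (v s))) 0 1 (\<lambda>s. fst (y s))"
    and 2: "integral_curve (\<lambda>s z. (T - \<xi>) *\<^sub>R f z (snd (v s))) 0 1 (\<lambda>s. fst (snd (y s)))"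
    unfolding integral_curve_P_dynamics_iff using \<xi>(1) by auto
  show "integral_curve (\<lambda>t z. f z (glue T \<xi> (\<lambda>s. fst (v s)) (\<lambda>s. snd (v s)) t)) 0 T
          (glue T \<xi> (\<lambda>s. fst (y s)) (\<lambda>s. fst (snd (y s))))"
    using \<xi>(2,3) 1 2 join by (rule integral_curve_glue)
qed

section \<open>Comparison of the two costs\<close>

lemma P_endpoint_target_iff:
  "P_endpoint g a b \<in> P_target x0 T \<longleftrightarrow>
    fst a = x0 \<and> 0 < snd (snd a) \<and> snd (snd a) < T \<and> fst (snd a) = fst b \<and> g (fst b) = 0"
  by (auto simp: P_endpoint_def P_target_def split_def)

text \<open>The integrand vanishes up to \<xi> and is at most 1 afterwards, wherever the trajectory
  goes.\<close>

lemma crisis_cost_le: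
  assumes traj: "trajectory f x0 T u = x" and \<xi>: "0 \<le> \<xi>" "\<xi> \<le> T"
    and K: "\<And>t. t \<in> {0..\<xi>} \<Longrightarrow> x t \<in> K"
  shows "crisis_cost f \<phi> K x0 T u \<le> \<phi> (x T) + T - \<xi>"
proof -
  let ?i = "\<lambda>t. indicator (- K) (x t) :: real"
  have "integral {0..T} ?i \<le> T - \<xi>"
  \<comment> \<open>The integral of a non-integrable function has the default value 0, which also
    satisfies the bound because \<open>\<xi> \<le> T\<close>.\<close>
  proof (cases "?i integrable_on {0..T}")
    case True
    have "((\<lambda>t. if t \<in> {\<xi>..T} then 1 else 0 :: real) has_integral T - \<xi>) {0..T}"
      using has_integral_restrict[of "{\<xi>..T}" "{0..T}" "\<lambda>_. 1::real"] has_integral_const_real[of "1::real" \<xi> T] \<xi>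
      by simp
    moreover have "?i t \<le> (if t \<in> {\<xi>..T} then 1 else 0)" if "t \<in> {0..T}" for t
      using K[of t] that by (auto simp: indicator_def)
    ultimately show ?thesis
      using integrable_integral[OF True] by (rule has_integral_le[rotated])
  qed (use \<xi> in \<open>simp add: not_integrable_integral\<close>)
  then show ?thesis
    by (simp add: crisis_cost_def traj)
qed

lemma crisis_cost_eq:
  assumes traj: "trajectory f x0 T u = x" and \<tau>: "0 \<le> \<tau>" "\<tau> \<le> T"
    and K: "\<And>t. t \<in> {0..\<tau>} \<Longrightarrow> x t \<in> K" "\<And>t. t \<in> {\<tau><..T} \<Longrightarrow> x t \<notin> K"
  shows "crisis_cost f \<phi> K x0 T u = \<phi> (x T) + T - \<tau>"
proof -
  have "((\<lambda>t. if t \<in> {\<tau>..T} then 1 else 0 :: real) has_integral T - \<tau>) {0..T}"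
    using has_integral_restrict[of "{\<tau>..T}" "{0..T}" "\<lambda>_. 1::real"] has_integral_const_real[of "1::real" \<tau> T] \<tau>
    by simp
  then have "((\<lambda>t. indicator (- K) (x t) :: real) has_integral T - \<tau>) {0..T}"
    by (rule has_integral_spike[of "{\<tau>}", rotated 2]) (use K \<tau> in \<open>auto simp: indicator_def\<close>)
  then show ?thesis
    by (simp add: crisis_cost_def traj integral_unique)
qed

lemma is_trajectory_restrict:
  fixes f :: "real^'n \<Rightarrow> real^'m \<Rightarrow> real^'n"
  assumes growth: "\<forall>x. \<forall>u\<in>U. norm (f x u) \<le> c1 * norm x + c2" and "c1 > 0"
    and u: "u \<in> controls 0 T U" and x: "integral_curve (\<lambda>t z. f z (u t)) 0 T x" "x 0 = x0" and "T \<ge> 0"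
  shows "is_trajectory f x0 T u (restrict x {0..T})"
proof -
  from x(1) have "integral_curve (\<lambda>t z. f z (u t)) 0 T (restrict x {0..T})"
    by (rule integral_curve_cong[THEN iffD1, rotated 2]) auto
  then show ?thesis
    using x(2) \<open>T \<ge> 0\<close> by (simp add: is_trajectory_iff_integral_curve[OF growth \<open>c1 > 0\<close> u])
qed

lemma trajectory_eq:
  assumes "\<exists>!x. is_trajectory f x0 T u x" "is_trajectory f x0 T u x"
  shows "trajectory f x0 T u = x"
  unfolding trajectory_def
proof (rule the_equality)
  show "is_trajectory f x0 T u x" by fact
  show "z = x" if "is_trajectory f x0 T u z" for z
    using assms that by blast
qed

text \<open>The term \<open>T - \<xi>\<close> in the cost of (P) charges the whole second half as if
  it lay outside \<open>K\<close>. It therefore dominates the true crisis time as soon as the first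
  half stays in \<open>K\<close>.\<close>

lemma crisis_cost_le_P_cost:
  fixes f :: "real^'n \<Rightarrow> real^'m \<Rightarrow> real^'n"
  assumes growth: "\<forall>x. \<forall>u\<in>U. norm (f x u) \<le> c1 * norm x + c2" and "c1 > 0"
    and unique: "\<forall>u\<in>controls 0 T U. \<exists>!x. is_trajectory f x0 T u x"
    and P: "(y, v) \<in> P_trajectories f T U" and target: "P_endpoint g (y 0) (y 1) \<in> P_target x0 T"
    and K: "\<And>s. s \<in> {0..1} \<Longrightarrow> fst (y s) \<in> K"
  obtains u where "u \<in> controls 0 T U" "crisis_cost f \<phi> K x0 T u \<le> P_cost \<phi> T (y 1)"
proof -
  define \<xi> where "\<xi> = snd (snd (y 0))"
  have \<xi>: "0 < \<xi>" "\<xi> < T" and start: "fst (y 0) = x0" and join: "fst (snd (y 0)) = fst (y 1)"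
    using target by (auto simp: P_endpoint_target_iff \<xi>_def)
  let ?u = "glue T \<xi> (\<lambda>s. fst (v s)) (\<lambda>s. snd (v s))" and ?x = "glue T \<xi> (\<lambda>s. fst (y s)) (\<lambda>s. fst (snd (y s)))"
  note G = P_trajectories_glue[OF growth \<open>c1 > 0\<close> P \<xi>_def \<xi> join]
  have "?x 0 = x0"
    using \<xi> start by (simp add: glue_def)
  then have "is_trajectory f x0 T ?u (restrict ?x {0..T})"
    using G(4) \<xi> by (intro is_trajectory_restrict[OF growth \<open>c1 > 0\<close> G(1)]) auto
  then have traj: "trajectory f x0 T ?u = restrict ?x {0..T}"
    using unique G(1) by (intro trajectory_eq) auto
  have "crisis_cost f \<phi> K x0 T ?u \<le> \<phi> (restrict ?x {0..T} T) + T - \<xi>"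
  proof (rule crisis_cost_le[OF traj])
    show "restrict ?x {0..T} t \<in> K" if "t \<in> {0..\<xi>}" for t
      using that \<xi> K[of "t / \<xi>"] by (simp add: glue_def)
  qed (use \<xi> in auto)
  moreover have "restrict ?x {0..T} T = fst (snd (y 1))"
    using \<xi> by (simp add: glue_def)
  \<comment> \<open>The cost reads \<xi> at s = 1, whereas the endpoint constraint bounds it at s =
    0.\<close>
  moreover have "snd (snd (y 1)) = \<xi>"
  proof -
    have "v \<in> controls 0 1 (U \<times> U)"
      using P by (simp add: P_trajectories_def)
    then have "integral_curve (\<lambda>s z. P_dynamics f T z (v s)) 0 1 y"
      using P P_trajectories_iff_integral_curve[OF growth \<open>c1 > 0\<close>] by blast
    then show ?thesis
      unfolding integral_curve_P_dynamics_iff \<xi>_def by auto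
  qed
  ultimately have "crisis_cost f \<phi> K x0 T ?u \<le> P_cost \<phi> T (y 1)"
    by (simp add: P_cost_def split_def)
  with G(1) show thesis by (rule that)
qed

text \<open>The opposite passage, by rescaling the pieces before and after \<tau>. The functions
  \<open>y\<close> and \<open>v\<close> are prescribed on [0,1] only, as the pair in the theorem
  is.\<close>

lemma P_trajectory_of_trajectory:
  fixes f :: "real^'n \<Rightarrow> real^'m \<Rightarrow> real^'n"
  assumes growth: "\<forall>x. \<forall>u\<in>U. norm (f x u) \<le> c1 * norm x + c2" and "c1 > 0"
    and u: "u \<in> controls 0 T U" and x: "integral_curve (\<lambda>t z. f z (u t)) 0 T x" and \<tau>: "0 < \<tau>" "\<tau> < T"
    and y: "\<And>s. s \<in> {0..1} \<Longrightarrow> y s = (x (\<tau> * s), x ((T - \<tau>) * s + \<tau>), \<tau>)"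
    and v: "\<And>s. s \<in> {0..1} \<Longrightarrow> v s = (u (\<tau> * s), u ((T - \<tau>) * s + \<tau>))"
  shows "(y, v) \<in> P_trajectories f T U"
proof -
  have range1: "\<tau> * s + 0 \<in> {0..T}" if "s \<in> {0..1}" for s
    using that \<tau> mult_mono[of \<tau> T s 1] by auto
  have range2: "(T - \<tau>) * s + \<tau> \<in> {0..T}" if "s \<in> {0..1}" for s
  proof -
    have "(T - \<tau>) * s \<le> T - \<tau>" "0 \<le> (T - \<tau>) * s"
      using that \<tau> mult_left_mono[of s 1 "T - \<tau>"] by auto
    then show ?thesis
      using \<tau> unfolding atLeastAtMost_iff by linarith
  qed
  have u_meas: "u \<in> borel_measurable (lebesgue_on {0..T})"
    using u by (simp add: controls_def)
  have "(\<lambda>s. u (\<tau> * s + 0)) \<in> borel_measurable (lebesgue_on {0..1})"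
    using u_meas \<tau> range1 by (intro borel_measurable_lebesgue_on_affine) auto
  moreover have "(\<lambda>s. u ((T - \<tau>) * s + \<tau>)) \<in> borel_measurable (lebesgue_on {0..1})"
    using u_meas \<tau> range2 by (intro borel_measurable_lebesgue_on_affine) auto
  ultimately have "(\<lambda>s. (u (\<tau> * s), u ((T - \<tau>) * s + \<tau>))) \<in> borel_measurable (lebesgue_on {0..1})"
    by (intro borel_measurable_Pair) simp_all
  then have "v \<in> borel_measurable (lebesgue_on {0..1})"
    by (rule measurable_cong[THEN iffD1, rotated]) (simp add: v)
  moreover have "v s \<in> U \<times> U" if "s \<in> {0..1}" for s
    using u range1[OF that] range2[OF that] by (simp add: v[OF that] controls_def)
  ultimately have v_ctrl: "v \<in> controls 0 1 (U \<times> U)"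
    by (simp add: controls_def)
  have "integral_curve (\<lambda>t z. f z (u t)) 0 \<tau> x" "integral_curve (\<lambda>t z. f z (u t)) \<tau> T x"
    using x \<tau> by (auto intro: integral_curve_subinterval)
  from integral_curve_affine[OF this(1) \<tau>(1), of 0] integral_curve_affine[OF this(2), of "T - \<tau>" \<tau>]
  have x1: "integral_curve (\<lambda>s z. \<tau> *\<^sub>R f z (u (\<tau> * s))) 0 1 (\<lambda>s. x (\<tau> * s))"
    and x2: "integral_curve (\<lambda>s z. (T - \<tau>) *\<^sub>R f z (u ((T - \<tau>) * s + \<tau>))) 0 1 (\<lambda>s. x ((T - \<tau>) * s + \<tau>))"
    using \<tau> by simp_all
  have "integral_curve (\<lambda>s z. \<tau> *\<^sub>R f z (fst (v s))) 0 1 (\<lambda>s. fst (y s))"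
    using x1 by (rule integral_curve_cong[THEN iffD1, rotated 2]) (auto simp: y v)
  moreover have "integral_curve (\<lambda>s z. (T - \<tau>) *\<^sub>R f z (snd (v s))) 0 1 (\<lambda>s. fst (snd (y s)))"
    using x2 by (rule integral_curve_cong[THEN iffD1, rotated 2]) (auto simp: y v)
  moreover have "\<forall>s\<in>{0..1}. snd (snd (y s)) = \<tau>"
    by (simp add: y)
  ultimately have "integral_curve (\<lambda>s z. P_dynamics f T z (v s)) 0 1 y"
    unfolding integral_curve_P_dynamics_iff by blast
  then show ?thesis
    using P_trajectories_iff_integral_curve[OF growth \<open>c1 > 0\<close> v_ctrl] by blast
qed

section \<open>Compactness of nearby trajectories\<close>

text \<open>Joint continuity of \<open>f\<close> turns convergence of the curves and a.e.
  convergence of the controls into a.e. convergence of the integrands, and \<open>M\<close>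
  dominates them uniformly in \<open>k\<close>.\<close>

lemma integral_curve_limit:
  fixes f :: "'a::euclidean_space \<Rightarrow> 'b::euclidean_space \<Rightarrow> 'a"
  assumes cont: "continuous_on UNIV (\<lambda>(x, u). f x u)"
    and p: "\<And>k. integral_curve (\<lambda>s z. \<alpha> k *\<^sub>R f z (v k s)) a b (p k)"
    and M: "\<And>k s. s \<in> {a..b} \<Longrightarrow> norm (\<alpha> k *\<^sub>R f (p k s) (v k s)) \<le> M"
    and \<alpha>: "\<alpha> \<longlonglongrightarrow> \<alpha>'" and p_lim: "\<And>s. s \<in> {a..b} \<Longrightarrow> (\<lambda>k. p k s) \<longlonglongrightarrow> p' s"
    and "negligible N" and v_lim: "\<And>s. s \<in> {a..b} - N \<Longrightarrow> (\<lambda>k. v k s) \<longlonglongrightarrow> v' s"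
  shows "integral_curve (\<lambda>s z. \<alpha>' *\<^sub>R f z (v' s)) a b p'"
  unfolding integral_curve_def
proof
  fix t assume t: "t \<in> {a..b}"
  show "((\<lambda>r. \<alpha>' *\<^sub>R f (p' r) (v' r)) has_integral p' t - p' a) {a..t}"
  proof (rule has_integral_bounded_limit[OF _ _ \<open>negligible N\<close>])
    show "((\<lambda>r. \<alpha> k *\<^sub>R f (p k r) (v k r)) has_integral p k t - p k a) {a..t}" for k
      using p[of k] t by (simp add: integral_curve_def)
    show "norm (\<alpha> k *\<^sub>R f (p k r) (v k r)) \<le> M" if "r \<in> {a..t}" for k r
      using M t that by auto
    show "(\<lambda>k. \<alpha> k *\<^sub>R f (p k r) (v k r)) \<longlonglongrightarrow> \<alpha>' *\<^sub>R f (p' r) (v' r)" if r: "r \<in> {a..t} - N" for r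
    proof -
      have "(\<lambda>k. (p k r, v k r)) \<longlonglongrightarrow> (p' r, v' r)"
        using r t by (intro tendsto_Pair p_lim v_lim) auto
      from continuous_on_tendsto_compose[OF cont this]
      have "(\<lambda>k. f (p k r) (v k r)) \<longlonglongrightarrow> f (p' r) (v' r)"
        by simp
      with \<alpha> show ?thesis by (rule tendsto_scaleR)
    qed
    show "(\<lambda>k. p k t - p k a) \<longlonglongrightarrow> p' t - p' a"
      using t by (intro tendsto_diff p_lim) auto
  qed
qed

text \<open>The controls may be unbounded, so \<open>f\<close> need not be Lipschitz in the state uniformly along them
  and Gronwall's inequality does not give closeness of the trajectories. Compactness together with
  the unique solvability for \<open>ub\<close> does.\<close>

lemma P_trajectories_subconverge:
  fixes f :: "real^'n \<Rightarrow> real^'m \<Rightarrow> real^'n"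
  assumes growth: "\<forall>x. \<forall>u\<in>U. norm (f x u) \<le> c1 * norm x + c2" and "c1 > 0" "c2 > 0"
    and cont: "continuous_on UNIV (\<lambda>(x, u). f x u)"
    and ub: "ub \<in> controls 0 T U" and unique: "\<exists>!x. is_trajectory f x0 T ub x"
    and xb: "is_trajectory f x0 T ub xb" and \<tau>: "0 < \<tau>" "\<tau> < T"
    and P: "\<And>k. (Y k, V k) \<in> P_trajectories f T U"
    and start: "\<And>k. fst (Y k 0) = x0"
    and \<xi>: "\<And>k. \<xi> k = snd (snd (Y k 0))" "\<And>k. 0 < \<xi> k" "\<And>k. \<xi> k < T" "\<xi> \<longlonglongrightarrow> \<tau>"
    and join: "\<And>k. fst (snd (Y k 0)) = fst (Y k 1)"
    and V: "AE s in lebesgue_on {0..1}. (\<lambda>k. V k s) \<longlonglongrightarrow> (ub (\<tau> * s), ub ((T - \<tau>) * s + \<tau>))"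
  obtains \<kappa> where "strict_mono (\<kappa> :: nat \<Rightarrow> nat)"
    "\<And>e. e > 0 \<Longrightarrow> \<exists>N. \<forall>k\<ge>N. \<forall>s\<in>{0..1}. norm (fst (Y (\<kappa> k) s) - xb (\<tau> * s)) < e"
proof -
  define p where "p k s = fst (Y k s)" for k s
  define q where "q k s = fst (snd (Y k s))" for k s
  define v where "v k s = fst (V k s)" for k s
  define w where "w k s = snd (V k s)" for k s
  note G = P_trajectories_glue[OF growth \<open>c1 > 0\<close> P \<xi>(1,2,3) join]
  have p: "integral_curve (\<lambda>s z. \<xi> k *\<^sub>R f z (v k s)) 0 1 (p k)"
    and q: "integral_curve (\<lambda>s z. (T - \<xi> k) *\<^sub>R f z (w k s)) 0 1 (q k)"
    and u: "glue T (\<xi> k) (v k) (w k) \<in> controls 0 T U"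
    and x: "integral_curve (\<lambda>t z. f z (glue T (\<xi> k) (v k) (w k) t)) 0 T (glue T (\<xi> k) (p k) (q k))"
    for k using G[of k] unfolding p_def[abs_def] q_def[abs_def] v_def[abs_def] w_def[abs_def] by blast+
  have vw: "v k s \<in> U" "w k s \<in> U" if "s \<in> {0..1}" for k s
    using P[of k] that by (auto simp: P_trajectories_def controls_def v_def w_def mem_Times_iff)
  have p0: "p k 0 = x0" for k
    using start by (simp add: p_def)
  have q0: "q k 0 = p k 1" for k
    using join by (simp add: p_def q_def)
  \<comment> \<open>The bound of \<open>integral_curve_norm_bound\<close> on [0,T] from
    \<open>x0\<close>. Applying it to the glued curves makes it independent of
    \<open>k\<close>.\<close>
  define R where "R = 2 * (norm x0 + c2 * (T - 0)) * exp (2 * c1 * (T - 0))"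
  have x_bound: "norm (glue T (\<xi> k) (p k) (q k) t) \<le> R" if "t \<in> {0..T}" for k t
  proof -
    have x0: "glue T (\<xi> k) (p k) (q k) 0 = x0"
      using \<xi>(2)[of k] p0 by (simp add: glue_def)
    have "norm (f (glue T (\<xi> k) (p k) (q k) r) (glue T (\<xi> k) (v k) (w k) r))
        \<le> c1 * norm (glue T (\<xi> k) (p k) (q k) r) + c2" if "r \<in> {0..T}" for r
      using u[of k] that growth by (auto simp: controls_def)
    from integral_curve_norm_bound[OF x \<open>c1 > 0\<close> _ this that] \<open>c2 > 0\<close> show ?thesis
      by (simp add: R_def x0)
  qed
  have p_bound: "norm (p k s) \<le> R" if "s \<in> {0..1}" for k s
  proof -
    have "\<xi> k * s \<in> {0..T}"
      using that \<xi>(2,3)[of k] mult_mono[of "\<xi> k" T s 1] by auto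
    from x_bound[OF this, of k] show ?thesis
      using that \<xi>(2)[of k] by (simp add: glue_first)
  qed
  have q_bound: "norm (q k s) \<le> R" if "s \<in> {0..1}" for k s
  \<comment> \<open>At the joint the glued curve takes its value from \<open>p\<close>, so it does
    not read \<open>q k 0\<close>; there the bound comes from \<open>q k 0 = p k 1\<close>.\<close>
  proof (cases "s = 0")
    case True
    then show ?thesis using p_bound[of 1 k] q0 by simp
  next
    case False
    have "(T - \<xi> k) * s \<le> T - \<xi> k" "0 \<le> (T - \<xi> k) * s"
      using that \<xi>(3)[of k] mult_left_mono[of s 1 "T - \<xi> k"] by auto
    then have "(T - \<xi> k) * s + \<xi> k \<in> {0..T}"
      using \<xi>(2)[of k] by auto
    from x_bound[OF this, of k] show ?thesis
      using that False \<xi>(3)[of k] by (simp add: glue_second)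
  qed
  have "R \<ge> 0"
    using p_bound[of 0 0] norm_ge_zero order_trans by (metis atLeastAtMost_iff order_refl zero_le_one)
  define M where "M = T * (c1 * R + c2)"
  have f_bound: "norm (\<alpha> *\<^sub>R f z a) \<le> M" if "0 < \<alpha>" "\<alpha> < T" "norm z \<le> R" "a \<in> U" for \<alpha> z a
  proof -
    have "norm (f z a) \<le> c1 * norm z + c2" using growth that by auto
    also have "\<dots> \<le> c1 * R + c2" using that \<open>c1 > 0\<close> by simp
    finally have "\<bar>\<alpha>\<bar> * norm (f z a) \<le> T * (c1 * R + c2)"
      using that by (intro mult_mono) auto
    then show ?thesis by (simp add: M_def)
  qed
  have p_der: "norm (\<xi> k *\<^sub>R f (p k s) (v k s)) \<le> M" and q_der: "norm ((T - \<xi> k) *\<^sub>R f (q k s) (w k s)) \<le> M"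
    if "s \<in> {0..1}" for k s
    using that \<xi>(2,3)[of k] by (auto intro!: f_bound p_bound q_bound vw simp del: norm_scaleR)
  have "M \<ge> 0"
    using \<open>R \<ge> 0\<close> \<open>c1 > 0\<close> \<open>c2 > 0\<close> \<tau> by (simp add: M_def)
  have lip: "norm (p k s - p k t) \<le> M * \<bar>s - t\<bar>" "norm (q k s - q k t) \<le> M * \<bar>s - t\<bar>"
    if "s \<in> {0..1}" "t \<in> {0..1}" for k s t
    using lipschitz_onD[OF integral_curve_lipschitz[OF p p_der \<open>M \<ge> 0\<close>] that]
      lipschitz_onD[OF integral_curve_lipschitz[OF q q_der \<open>M \<ge> 0\<close>] that]
    by (auto simp: dist_norm)
  \<comment> \<open>Pairing the halves yields a single subsequence along which both converge. The
    limit of the second half is needed as well, since unique solvability concerns all of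
    [0,T].\<close>
  let ?Z = "\<lambda>k s. (p k s, q k s)"
  obtain Z \<kappa> where \<kappa>: "strict_mono (\<kappa> :: nat \<Rightarrow> nat)"
    and unif: "\<And>e. 0 < e \<Longrightarrow> \<exists>N. \<forall>k s. k \<ge> N \<and> s \<in> {0..1} \<longrightarrow> norm (?Z (\<kappa> k) s - Z s) < e"
  proof (rule Arzela_Ascoli[of "{0..1}" ?Z "2 * R"])
    show "norm (p k s, q k s) \<le> 2 * R" if "s \<in> {0..1}" for k s
      using norm_Pair_le[of "p k s" "q k s"] p_bound[OF that, of k] q_bound[OF that, of k] by linarith
    fix s e :: real assume s: "s \<in> {0..1}" and "0 < e"
    have "norm ((p k s, q k s) - (p k t, q k t)) < e" if t: "t \<in> {0..1}" "norm (s - t) < e / (2 * M + 1)" for k t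
    proof -
      have "norm ((p k s, q k s) - (p k t, q k t)) \<le> 2 * M * \<bar>s - t\<bar>"
        using norm_Pair_le[of "p k s - p k t" "q k s - q k t"] lip[OF s t(1), of k] by simp
      also have "\<dots> \<le> (2 * M + 1) * \<bar>s - t\<bar>"
        by (intro mult_right_mono) auto
      also have "\<dots> < e"
        using t(2) \<open>M \<ge> 0\<close> by (simp add: field_simps)
      finally show ?thesis .
    qed
    moreover have "0 < e / (2 * M + 1)"
      using \<open>0 < e\<close> \<open>M \<ge> 0\<close> by simp
    ultimately show "\<exists>d>0. \<forall>k t. t \<in> {0..1} \<and> norm (s - t) < d \<longrightarrow> norm ((p k s, q k s) - (p k t, q k t)) < e"
      by blast
  qed (use that in auto)
  define p' where "p' s = fst (Z s)" for s
  define q' where "q' s = snd (Z s)" for s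
  have Z_lim: "(\<lambda>k. ?Z (\<kappa> k) s) \<longlonglongrightarrow> Z s" if "s \<in> {0..1}" for s
    unfolding LIMSEQ_iff using unif that by meson
  have p_lim: "(\<lambda>k. p (\<kappa> k) s) \<longlonglongrightarrow> p' s" and q_lim: "(\<lambda>k. q (\<kappa> k) s) \<longlonglongrightarrow> q' s" if "s \<in> {0..1}" for s
    using tendsto_fst[OF Z_lim[OF that]] tendsto_snd[OF Z_lim[OF that]] by (auto simp: p'_def q'_def)
  have \<xi>_lim: "(\<lambda>k. \<xi> (\<kappa> k)) \<longlonglongrightarrow> \<tau>"
    using LIMSEQ_subseq_LIMSEQ[OF \<xi>(4) \<kappa>] by (simp add: o_def)
  define N where "N = {s\<in>{0..1}. \<not> (\<lambda>k. V k s) \<longlonglongrightarrow> (ub (\<tau> * s), ub ((T - \<tau>) * s + \<tau>))}"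
  have "negligible N"
    using V by (simp add: AE_lebesgue_on_iff_negligible N_def)
  have V_lim: "(\<lambda>k. V (\<kappa> k) s) \<longlonglongrightarrow> (ub (\<tau> * s), ub ((T - \<tau>) * s + \<tau>))" if "s \<in> {0..1} - N" for s
    using LIMSEQ_subseq_LIMSEQ[OF _ \<kappa>, of "\<lambda>k. V k s"] that by (simp add: N_def o_def)
  have p': "integral_curve (\<lambda>s z. \<tau> *\<^sub>R f z (ub (\<tau> * s))) 0 1 p'"
    using cont p p_der \<xi>_lim p_lim \<open>negligible N\<close>
  proof (rule integral_curve_limit[where v="\<lambda>k. v (\<kappa> k)" and p="\<lambda>k. p (\<kappa> k)"])
    show "(\<lambda>k. v (\<kappa> k) s) \<longlonglongrightarrow> ub (\<tau> * s)" if "s \<in> {0..1} - N" for s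
      using tendsto_fst[OF V_lim[OF that]] by (simp add: v_def)
  qed
  have "(\<lambda>k. T - \<xi> (\<kappa> k)) \<longlonglongrightarrow> T - \<tau>"
    by (intro tendsto_intros \<xi>_lim)
  with cont q q_der have q': "integral_curve (\<lambda>s z. (T - \<tau>) *\<^sub>R f z (ub ((T - \<tau>) * s + \<tau>))) 0 1 q'"
    using q_lim \<open>negligible N\<close>
  proof (rule integral_curve_limit[where v="\<lambda>k. w (\<kappa> k)" and p="\<lambda>k. q (\<kappa> k)"])
    show "(\<lambda>k. w (\<kappa> k) s) \<longlonglongrightarrow> ub ((T - \<tau>) * s + \<tau>)" if "s \<in> {0..1} - N" for s
      using tendsto_snd[OF V_lim[OF that]] by (simp add: w_def)
  qed
  have p'0: "p' 0 = x0"
    using p_lim[of 0] LIMSEQ_unique[OF tendsto_const] p0 by auto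
  have join': "q' 0 = p' 1"
    using p_lim[of 1] q_lim[of 0] LIMSEQ_unique q0 by auto
  \<comment> \<open>The gluing inverts the time change by \<tau>, so the glued limit is a trajectory
    of \<open>ub\<close> and unique solvability identifies it with \<open>xb\<close>.\<close>
  have "integral_curve (\<lambda>t z. f z (glue T \<tau> (\<lambda>s. ub (\<tau> * s)) (\<lambda>s. ub ((T - \<tau>) * s + \<tau>)) t)) 0 T (glue T \<tau> p' q')"
    using \<tau> p' q' join' by (rule integral_curve_glue)
  moreover have "glue T \<tau> (\<lambda>s. ub (\<tau> * s)) (\<lambda>s. ub ((T - \<tau>) * s + \<tau>)) t = ub t" for t
    using \<tau> by (simp add: glue_def)
  ultimately have "integral_curve (\<lambda>t z. f z (ub t)) 0 T (glue T \<tau> p' q')"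
    by simp
  then have "integral_curve (\<lambda>t z. f z (ub t)) 0 T (restrict (glue T \<tau> p' q') {0..T})"
    by (rule integral_curve_cong[THEN iffD1, rotated 2]) auto
  moreover have "restrict (glue T \<tau> p' q') {0..T} 0 = x0"
    using \<tau> p'0 by (simp add: glue_def)
  ultimately have "is_trajectory f x0 T ub (restrict (glue T \<tau> p' q') {0..T})"
    unfolding is_trajectory_iff_integral_curve[OF growth \<open>c1 > 0\<close> ub] by simp
  with unique xb have "xb = restrict (glue T \<tau> p' q') {0..T}"
    by blast
  moreover have "\<tau> * s \<in> {0..T}" if "s \<in> {0..1}" for s
    using that \<tau> mult_mono[of \<tau> T s 1] by auto
  ultimately have xb_eq: "xb (\<tau> * s) = p' s" if "s \<in> {0..1}" for s
    using that \<tau> by (simp add: glue_first)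
  show ?thesis
  proof (rule that[OF \<kappa>])
    fix e :: real assume "e > 0"
    then obtain N where N: "\<forall>k s. k \<ge> N \<and> s \<in> {0..1} \<longrightarrow> norm (?Z (\<kappa> k) s - Z s) < e"
      using unif by blast
    have "norm (fst (Y (\<kappa> k) s) - xb (\<tau> * s)) < e" if "k \<ge> N" "s \<in> {0..1}" for k s
    proof -
      have "norm (?Z (\<kappa> k) s - Z s) < e" using N that by blast
      moreover have "norm (p (\<kappa> k) s - p' s) \<le> norm (?Z (\<kappa> k) s - Z s)"
        using norm_fst_le[of "p (\<kappa> k) s - p' s" "q (\<kappa> k) s - q' s"]
        by (simp add: p'_def q'_def minus_prod_def)
      ultimately show ?thesis
        using that by (simp add: xb_eq p_def)
    qed
    then show "\<exists>N. \<forall>k\<ge>N. \<forall>s\<in>{0..1}. norm (fst (Y (\<kappa> k) s) - xb (\<tau> * s)) < e"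
      by blast
  qed
qed

section \<open>Transversality\<close>

text \<open>\<open>gradient\<close> is a definite description, so a representing vector has to be
  exhibited and shown unique; it is assembled from the values of the derivative on
  \<open>Basis\<close>.\<close>

lemma gradient_inner:
  fixes g :: "'a::euclidean_space \<Rightarrow> real"
  assumes g: "(g has_derivative g') (at x)"
  shows "h \<bullet> gradient g x = g' h"
proof -
  define D where "D = (\<Sum>b\<in>Basis. g' b *\<^sub>R b)"
  interpret bounded_linear g' using g by (rule has_derivative_bounded_linear)
  have D: "h \<bullet> D = g' h" for h
    using sum[of "\<lambda>b. (h \<bullet> b) *\<^sub>R b" Basis]
    by (simp add: D_def inner_sum_right scaleR euclidean_representation mult.commute)
  have "GDERIV g x :> D"
    unfolding gderiv_def using g D by (simp add: D[abs_def])
  moreover have "E = D" if "GDERIV g x :> E" for E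
  proof -
    have "(\<lambda>h. h \<bullet> E) = (\<lambda>h. h \<bullet> D)"
      using that \<open>GDERIV g x :> D\<close> unfolding gderiv_def by (rule has_derivative_unique)
    then show ?thesis
      using vector_eq_ldot[of E D] by (simp add: fun_eq_iff)
  qed
  ultimately have "gradient g x = D"
    unfolding gradient_def by (rule the_equality)
  then show ?thesis using D by simp
qed

lemma connected_nonzero_neg:
  fixes k :: "'a::topological_space \<Rightarrow> real"
  assumes "continuous_on S k" "connected S" "\<And>t. t \<in> S \<Longrightarrow> k t \<noteq> 0" "a \<in> S" "k a < 0" "b \<in> S"
  shows "k b < 0"
proof (rule ccontr)
  assume "\<not> k b < 0"
  then have "0 \<in> k ` S"
    using connectedD_interval[OF connected_continuous_image[OF assms(1,2)], of "k a" "k b" 0] assms(4-6)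
    by auto
  then show False using assms(3) by auto
qed

text \<open>The mean value theorem is applied along the segment from \<open>a\<close> to
  \<open>b\<close>, not along the curve, which is differentiable only almost everywhere. At the
  intermediate point \<open>z\<close> the functional \<open>g' z\<close> is fixed and can be moved
  inside the integral of \<open>k\<close>. This is why \<open>pos\<close> lets \<open>z\<close>
  range over \<open>S\<close> independently of \<open>r\<close>.\<close>

lemma C1_le_along_integral:
  fixes g :: "'a::euclidean_space \<Rightarrow> real"
  assumes deriv: "\<And>z. (g has_derivative blinfun_apply (g' z)) (at z)"
    and k: "(k has_integral (b - a)) {s..t}" and S: "convex S" "a \<in> S" "b \<in> S"
    and N: "negligible N" and pos: "\<And>z r. z \<in> S \<Longrightarrow> r \<in> {s..t} - N \<Longrightarrow> 0 \<le> blinfun_apply (g' z) (k r)"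
  shows "g a \<le> g b"
proof -
  define l where "l \<theta> = a + \<theta> *\<^sub>R (b - a)" for \<theta> :: real
  have l: "l \<theta> \<in> S" if "\<theta> \<in> {0..1}" for \<theta>
    using convexD_alt[OF S, of \<theta>] that by (simp add: l_def algebra_simps)
  have "((\<lambda>\<theta>. g (l \<theta>)) has_derivative (\<lambda>h. blinfun_apply (g' (l \<theta>)) (h *\<^sub>R (b - a)))) (at \<theta> within {0..1})" for \<theta>
  proof (rule has_derivative_compose[of l _ _ _ g])
    show "(l has_derivative (\<lambda>h. h *\<^sub>R (b - a))) (at \<theta> within {0..1})"
      unfolding l_def by (auto intro!: derivative_eq_intros)
  qed (rule deriv)
  from mvt_simple[OF zero_less_one this]
  obtain \<theta> where \<theta>: "\<theta> \<in> {0<..<1}" "g (l 1) - g (l 0) = blinfun_apply (g' (l \<theta>)) (b - a)"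
    by auto
  have "((\<lambda>r. blinfun_apply (g' (l \<theta>)) (k r)) has_integral blinfun_apply (g' (l \<theta>)) (b - a)) {s..t}"
    using has_integral_linear[OF k blinfun.bounded_linear_right] by (simp add: o_def)
  then have "((\<lambda>r. if r \<in> N then 0 else blinfun_apply (g' (l \<theta>)) (k r)) has_integral blinfun_apply (g' (l \<theta>)) (b - a)) {s..t}"
    by (rule has_integral_spike[OF N, rotated]) auto
  then have "0 \<le> blinfun_apply (g' (l \<theta>)) (b - a)"
    by (rule has_integral_nonneg) (use pos l \<theta>(1) in auto)
  with \<theta>(2) show ?thesis by (simp add: l_def)
qed

text \<open>The state \<open>y\<close> in the dynamics and the base point \<open>z\<close> of the
  derivative vary independently, as \<open>C1_le_along_integral\<close> requires. The radius
  \<open>e/3\<close> reflects that the norm of a triple is at most the sum of three norms.\<close>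

lemma C1_positive_near:
  fixes f :: "'a::euclidean_space \<Rightarrow> 'b::euclidean_space \<Rightarrow> 'a" and g' :: "'a \<Rightarrow> 'a \<Rightarrow>\<^sub>L real"
  assumes cont: "continuous_on UNIV (\<lambda>(x, u). f x u)" and g': "continuous_on UNIV g'"
    and pos: "blinfun_apply (g' x) (f x u) > 0"
  obtains \<rho> where "\<rho> > 0"
    "\<And>y w z. \<lbrakk>norm (y - x) < \<rho>; norm (w - u) < \<rho>; norm (z - x) < \<rho>\<rbrakk> \<Longrightarrow> blinfun_apply (g' z) (f y w) > 0"
proof -
  define H where "H p = blinfun_apply (g' (snd (snd p))) (f (fst p) (fst (snd p)))" for p
  have "continuous_on UNIV (\<lambda>p. f (fst p) (fst (snd p)))"
    using continuous_on_compose2[OF cont, of UNIV "\<lambda>p. (fst p, fst (snd p))"]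
    by (simp add: continuous_on_Pair continuous_on_fst continuous_on_snd continuous_on_id)
  moreover have "continuous_on UNIV (\<lambda>p. g' (snd (snd p)))"
    by (rule continuous_on_compose2[OF g']) (auto intro!: continuous_intros)
  ultimately have "continuous_on UNIV H"
    unfolding H_def by (intro continuous_intros)
  then have "open (H -` {0<..})"
    by (intro open_vimage) auto
  moreover have "(x, u, x) \<in> H -` {0<..}"
    using pos by (simp add: H_def)
  ultimately obtain e where "e > 0" and e: "ball (x, u, x) e \<subseteq> H -` {0<..}"
    by (meson openE)
  show thesis
  proof (rule that[of "e/3"])
    fix y w z assume *: "norm (y - x) < e/3" "norm (w - u) < e/3" "norm (z - x) < e/3"
    have "norm (y - x, w - u, z - x) \<le> norm (y - x) + (norm (w - u) + norm (z - x))"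
      by (meson add_left_mono norm_Pair_le order_trans)
    then have "dist (y, w, z) (x, u, x) < e"
      using * by (simp add: dist_norm)
    then have "dist (x, u, x) (y, w, z) < e"
      by (simp add: dist_commute)
    then have "(y, w, z) \<in> H -` {0<..}"
      using e by auto
    then show "blinfun_apply (g' z) (f y w) > 0"
      by (simp add: H_def)
  qed (use \<open>e > 0\<close> in simp)
qed

text \<open>The window for \<open>u\<close> is half-open because a left limit says nothing about the
  value at \<open>b\<close>.\<close>

lemma tendsto_at_left_window:
  fixes x :: "real \<Rightarrow> 'a::real_normed_vector" and u :: "real \<Rightarrow> 'b::real_normed_vector"
  assumes x: "continuous_on {a..b} x" and "a < b" and u: "(u \<longlongrightarrow> w) (at_left b)" and "e > 0"
  obtains c where "a < c" "c < b"
    "\<And>t. t \<in> {c..b} \<Longrightarrow> norm (x t - x b) < e" "\<And>t. t \<in> {c..<b} \<Longrightarrow> norm (u t - w) < e"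
proof -
  have "\<exists>d>0. \<forall>t\<in>{a..b}. dist t b < d \<longrightarrow> dist (x t) (x b) < e"
    using x \<open>a < b\<close> \<open>e > 0\<close> unfolding continuous_on_iff by auto
  then obtain d where "d > 0" and d: "\<And>t. t \<in> {a..b} \<Longrightarrow> dist t b < d \<Longrightarrow> dist (x t) (x b) < e"
    by blast
  have "eventually (\<lambda>t. dist (u t) w < e) (at_left b)"
    using u \<open>e > 0\<close> by (rule tendstoD)
  then have "\<exists>c'<b. \<forall>t>c'. t < b \<longrightarrow> dist (u t) w < e"
    unfolding eventually_at_left[OF \<open>a < b\<close>] .
  then obtain c' where "c' < b" and c': "\<And>t. c' < t \<Longrightarrow> t < b \<Longrightarrow> dist (u t) w < e"
    by blast
  have "max (max a c') (b - d) < b"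
    using \<open>a < b\<close> \<open>c' < b\<close> \<open>d > 0\<close> by simp
  then obtain c where "max (max a c') (b - d) < c" "c < b"
    using dense by blast
  then have c: "a < c" "c < b" "c' < c" "b - d < c"
    by auto
  show thesis
  proof (rule that[OF c(1,2)])
    show "norm (x t - x b) < e" if "t \<in> {c..b}" for t
      using d[of t] c that by (auto simp: dist_norm)
    show "norm (u t - w) < e" if "t \<in> {c..<b}" for t
      using c'[of t] c that by (auto simp: dist_norm)
  qed
qed

text \<open>Were the derivative negative, \<open>- g\<close> would not decrease along
  \<open>x\<close> just before \<open>b\<close>, so \<open>g\<close> would already be nonnegative
  there.\<close>

lemma sign_of_arrival_derivative:
  fixes f :: "'a::euclidean_space \<Rightarrow> 'b::euclidean_space \<Rightarrow> 'a" and g :: "'a \<Rightarrow> real"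
  assumes cont: "continuous_on UNIV (\<lambda>(x, u). f x u)"
    and deriv: "\<And>z. (g has_derivative blinfun_apply (g' z)) (at z)" and g': "continuous_on UNIV g'"
    and x: "integral_curve (\<lambda>t z. f z (u t)) 0 b x" and "0 < b" and u: "(u \<longlongrightarrow> w) (at_left b)"
    and neg: "\<And>t. t \<in> {0..<b} \<Longrightarrow> g (x t) < 0" and zero: "g (x b) = 0"
  shows "blinfun_apply (g' (x b)) (f (x b) w) \<ge> 0"
proof (rule ccontr)
  assume "\<not> ?thesis"
  then have "blinfun_apply (- g' (x b)) (f (x b) w) > 0"
    by (simp add: blinfun.minus_left)
  with cont g' obtain \<rho> where "\<rho> > 0" and
    \<rho>: "\<And>y w' z. \<lbrakk>norm (y - x b) < \<rho>; norm (w' - w) < \<rho>; norm (z - x b) < \<rho>\<rbrakk> \<Longrightarrow> blinfun_apply (- g' z) (f y w') > 0"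
    using C1_positive_near[of f "\<lambda>z. - g' z" "x b" w] by (metis continuous_on_minus)
  obtain c where c: "0 < c" "c < b"
    "\<And>t. t \<in> {c..b} \<Longrightarrow> norm (x t - x b) < \<rho>" "\<And>t. t \<in> {c..<b} \<Longrightarrow> norm (u t - w) < \<rho>"
    using tendsto_at_left_window[OF integral_curve_continuous[OF x] \<open>0 < b\<close> u \<open>\<rho> > 0\<close>] by blast
  \<comment> \<open>The exceptional set is \<open>{b}\<close>, since \<open>u\<close> is known to be
    close to \<open>w\<close> only strictly before \<open>b\<close>.\<close>
  have "- g (x c) \<le> - g (x b)"
  proof (rule C1_le_along_integral[where g="\<lambda>z. - g z" and S="ball (x b) \<rho>" and N="{b}"])
    show "((\<lambda>z. - g z) has_derivative blinfun_apply (- g' z)) (at z)" for z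
      using has_derivative_minus[OF deriv[of z]] by (simp add: uminus_blinfun.rep_eq)
    show "((\<lambda>r. f (x r) (u r)) has_integral x b - x c) {c..b}"
      using c by (intro integral_curve_has_integral[OF x]) auto
    show "0 \<le> blinfun_apply (- g' z) (f (x r) (u r))" if "z \<in> ball (x b) \<rho>" "r \<in> {c..b} - {b}" for z r
      using that by (intro less_imp_le \<rho> c) (auto simp: dist_norm norm_minus_commute)
  qed (use c(2) c(3)[of c] \<open>\<rho> > 0\<close> in \<open>auto simp: dist_norm norm_minus_commute\<close>)
  then show False
    using neg[of c] zero c by simp
qed

section \<open>The weak minimum\<close>

theorem proposition3p2:
  fixes T c1 c2 \<epsilon> \<delta> \<tau> :: real
    and x0 :: "real^'n"
    and U :: "(real^'m) set"
    and f :: "real^'n \<Rightarrow> real^'m \<Rightarrow> real^'n"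
    and \<phi> g :: "real^'n \<Rightarrow> real"
    and K :: "(real^'n) set"
    and c :: "real^'m \<Rightarrow> real^'l"
    and ub ut :: "real \<Rightarrow> real^'m"
    and xb xt :: "real \<Rightarrow> real^'n"
    and um up :: "real^'m"
    and yb :: "real \<Rightarrow> (real^'n) \<times> (real^'n) \<times> real"
    and vb :: "real \<Rightarrow> (real^'m) \<times> (real^'m)"
  assumes "T > 0"
    and "U \<noteq> {}" and "closed U"
    and "of_class_C2 (\<lambda>(x, u). f x u)"
    and "c1 > 0" and "c2 > 0"
    and "\<forall>x. \<forall>u\<in>U. norm (f x u) \<le> c1 * norm x + c2"
    and "\<forall>x. f x ` U \<noteq> {} \<and> compact (f x ` U) \<and> convex (f x ` U)"
    and "of_class_C2 \<phi>"
    and "closed K" and "interior K \<noteq> {}"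
    and unique_trajectory: "\<forall>u\<in>controls 0 T U. \<exists>!x. is_trajectory f x0 T u x"
    and minimizer: "global_minimizer f \<phi> K x0 T U ub"
    and xb: "xb = trajectory f x0 T ub"
    and "of_class_C2 c" and "U = {u. \<forall>i. c u $ i \<le> 0}"
    and "\<epsilon> > 0" and "\<delta> > 0"
    and qualification:
      "AE t in lebesgue_on {0<..<T}. \<forall>\<xi>::real^'l.
         (\<forall>i. i \<notin> {i. c (ub t) $ i \<ge> - \<delta>} \<longrightarrow> \<xi> $ i = 0) \<longrightarrow>
         \<epsilon> * norm \<xi> \<le>
           norm (\<Sum>i\<in>{i. c (ub t) $ i \<ge> - \<delta>}. \<xi> $ i *\<^sub>R gradient (\<lambda>u. c u $ i) (ub t))"
    and "of_class_C1 g" and "K = {x. g x \<le> 0}"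
    and "crossing_times K T xb = {\<tau>}" and "exit_crossing K xb \<tau>"
    and "(ub \<longlongrightarrow> um) (at_left \<tau>)" and "(ub \<longlongrightarrow> up) (at_right \<tau>)"
    and "f (xb \<tau>) um \<bullet> gradient g (xb \<tau>) \<noteq> 0"
    and "f (xb \<tau>) up \<bullet> gradient g (xb \<tau>) \<noteq> 0"
    and "\<forall>t\<in>{0..T} - {\<tau>}. g (xb t) \<noteq> 0"
    and ut: "ut = ub \<circ> time_change T \<tau>"
    and xt: "xt = xb \<circ> time_change T \<tau>"
    and yb: "\<forall>s\<in>{0..1}. yb s = (xt s, xt (s + 1), \<tau>)"
    and vb: "\<forall>s\<in>{0..1}. vb s = (ut s, ut (s + 1))"
  shows "P_weak_minimum f g \<phi> x0 T U yb vb"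
proof -

  \<comment> \<open>Regularity and the reference trajectory\<close>
  note growth = \<open>\<forall>x. \<forall>u\<in>U. norm (f x u) \<le> c1 * norm x + c2\<close>
  note nonzero = \<open>\<forall>t\<in>{0..T} - {\<tau>}. g (xb t) \<noteq> 0\<close>
  have "\<exists>F. \<forall>z. ((\<lambda>(x, u). f x u) has_derivative blinfun_apply (F z)) (at z)"
    using \<open>of_class_C2 (\<lambda>(x, u). f x u)\<close> unfolding of_class_C2_def by blast
  then have cont: "continuous_on UNIV (\<lambda>(x, u). f x u)"
    by (meson has_derivative_continuous continuous_at_imp_continuous_on)
  obtain g' where deriv: "\<And>z. (g has_derivative blinfun_apply (g' z)) (at z)" and g': "continuous_on UNIV g'"
    using \<open>of_class_C1 g\<close> unfolding of_class_C1_def by blast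
  have cont_g: "continuous_on UNIV g"
    using deriv by (meson has_derivative_continuous continuous_at_imp_continuous_on)
  have \<tau>: "0 < \<tau>" "\<tau> < T"
    using \<open>crossing_times K T xb = {\<tau>}\<close> by (auto simp: crossing_times_def)
  have ub: "ub \<in> controls 0 T U"
    using minimizer by (simp add: global_minimizer_def)
  have unique: "\<exists>!x. is_trajectory f x0 T ub x"
    using unique_trajectory ub by blast
  have traj: "is_trajectory f x0 T ub xb"
    using theI'[OF unique] unfolding xb trajectory_def .
  then have xb_curve: "integral_curve (\<lambda>t z. f z (ub t)) 0 T xb" and xb0: "xb 0 = x0"
    by (simp_all add: is_trajectory_iff_integral_curve[OF growth \<open>c1 > 0\<close> ub])
  have xb_cont: "continuous_on {0..T} xb"
    using xb_curve by (rule integral_curve_continuous)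
  have gxb_cont: "continuous_on {0..T} (\<lambda>t. g (xb t))"
    by (rule continuous_on_compose2[OF cont_g xb_cont]) simp

  \<comment> \<open>Sign of \<open>g\<close> along the reference trajectory\<close>
  obtain \<eta> where "\<eta> > 0" and before: "\<And>t. \<tau> - \<eta> < t \<Longrightarrow> t \<le> \<tau> \<Longrightarrow> g (xb t) \<le> 0"
    and after: "\<And>t. \<tau> < t \<Longrightarrow> t < \<tau> + \<eta> \<Longrightarrow> g (xb t) > 0"
    using \<open>exit_crossing K xb \<tau>\<close> \<open>K = {x. g x \<le> 0}\<close> unfolding exit_crossing_def
    by (auto simp: not_le)
  obtain t\<^sub>1 where t1: "max 0 (\<tau> - \<eta>) < t\<^sub>1" "t\<^sub>1 < \<tau>"
    using dense[of "max 0 (\<tau> - \<eta>)" \<tau>] \<tau> \<open>\<eta> > 0\<close> by auto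
  obtain t\<^sub>2 where t2: "\<tau> < t\<^sub>2" "t\<^sub>2 < min T (\<tau> + \<eta>)"
    using dense[of \<tau> "min T (\<tau> + \<eta>)"] \<tau> \<open>\<eta> > 0\<close> by auto
  have neg: "g (xb t) < 0" if "t \<in> {0..<\<tau>}" for t
  proof (rule connected_nonzero_neg[of "{0..<\<tau>}" "\<lambda>t. g (xb t)" t\<^sub>1])
    show "continuous_on {0..<\<tau>} (\<lambda>t. g (xb t))"
      using \<tau> by (intro continuous_on_subset[OF gxb_cont]) auto
    show "g (xb t\<^sub>1) < 0"
      using before[of t\<^sub>1] nonzero[rule_format, of t\<^sub>1] t1 \<tau> by auto
  qed (use nonzero \<tau> t1 that in auto)
  have pos: "- g (xb t) < 0" if "t \<in> {\<tau><..T}" for t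
  proof (rule connected_nonzero_neg[of "{\<tau><..T}" "\<lambda>t. - g (xb t)" t\<^sub>2])
    show "continuous_on {\<tau><..T} (\<lambda>t. - g (xb t))"
      using \<tau> by (intro continuous_on_minus continuous_on_subset[OF gxb_cont]) auto
  qed (use nonzero \<tau> t2 after[of t\<^sub>2] that in auto)
  \<comment> \<open>Otherwise \<open>g\<close> would be negative at \<tau> and vanish nowhere along
    the trajectory, so it would stay negative up to \<open>T\<close>.\<close>
  have zero: "g (xb \<tau>) = 0"
  proof (rule ccontr)
    assume "g (xb \<tau>) \<noteq> 0"
    then have "g (xb T) < 0"
      using before[of \<tau>] \<open>\<eta> > 0\<close> nonzero \<tau>
      by (intro connected_nonzero_neg[OF gxb_cont, of \<tau> T]) auto
    then show False
      using pos[of T] \<tau> by simp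
  qed

  \<comment> \<open>Margins near and away from the crossing\<close>
  have "f (xb \<tau>) um \<bullet> gradient g (xb \<tau>) = blinfun_apply (g' (xb \<tau>)) (f (xb \<tau>) um)"
    by (rule gradient_inner[OF deriv])
  moreover have "blinfun_apply (g' (xb \<tau>)) (f (xb \<tau>) um) \<ge> 0"
    using integral_curve_subinterval[OF xb_curve, of 0 \<tau>] \<tau> \<open>(ub \<longlongrightarrow> um) (at_left \<tau>)\<close> neg zero
    by (intro sign_of_arrival_derivative[OF cont deriv g']) auto
  ultimately have "blinfun_apply (g' (xb \<tau>)) (f (xb \<tau>) um) > 0"
    using \<open>f (xb \<tau>) um \<bullet> gradient g (xb \<tau>) \<noteq> 0\<close> by simp
  with cont g' obtain \<rho> where "\<rho> > 0" and
    \<rho>: "\<And>y w z. \<lbrakk>norm (y - xb \<tau>) < \<rho>; norm (w - um) < \<rho>; norm (z - xb \<tau>) < \<rho>\<rbrakk> \<Longrightarrow> blinfun_apply (g' z) (f y w) > 0"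
    by (rule C1_positive_near) blast
  have "continuous_on {0..\<tau>} xb"
    using \<tau> by (intro continuous_on_subset[OF xb_cont]) auto
  \<comment> \<open>The other half of \<rho> is kept for the distance between a nearby pair and the
    reference pair.\<close>
  then obtain a where a: "0 < a" "a < \<tau>"
    "\<And>t. t \<in> {a..\<tau>} \<Longrightarrow> norm (xb t - xb \<tau>) < \<rho>/2" "\<And>t. t \<in> {a..<\<tau>} \<Longrightarrow> norm (ub t - um) < \<rho>/2"
    using tendsto_at_left_window[of 0 \<tau> xb ub um "\<rho>/2"] \<tau> \<open>\<rho> > 0\<close> \<open>(ub \<longlongrightarrow> um) (at_left \<tau>)\<close> by auto
  \<comment> \<open>Up to time \<open>a\<close> the trajectory is a compact subset of the open set
    where \<open>g\<close> is negative, which gives a uniform margin \<gamma>.\<close>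
  have "compact (xb ` {0..a})"
    using a \<tau> by (intro compact_continuous_image continuous_on_subset[OF xb_cont]) auto
  moreover have "open {x. g x < 0}"
    using open_vimage[OF open_lessThan[of 0] cont_g] by (simp add: vimage_def)
  moreover have "xb ` {0..a} \<subseteq> {x. g x < 0}"
    using neg a by auto
  ultimately obtain \<gamma> where "\<gamma> > 0" and \<gamma>: "(\<Union>x\<in>xb ` {0..a}. ball x \<gamma>) \<subseteq> {x. g x < 0}"
    by (rule compact_subset_open_imp_ball_epsilon_subset)

  \<comment> \<open>Admissibility and cost of the reference pair\<close>
  have yb': "yb s = (xb (\<tau> * s), xb ((T - \<tau>) * s + \<tau>), \<tau>)" and vb': "vb s = (ub (\<tau> * s), ub ((T - \<tau>) * s + \<tau>))"
    if "s \<in> {0..1}" for s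
    \<comment> \<open>For \<open>s = 0\<close> the argument \<open>s + 1\<close> falls into the
      first branch of \<open>time_change\<close>; both branches give \<tau> there.\<close>
    using that yb vb by (auto simp: xt ut time_change_def algebra_simps)
  have yb_P: "(yb, vb) \<in> P_trajectories f T U"
    by (rule P_trajectory_of_trajectory[OF growth \<open>c1 > 0\<close> ub xb_curve \<tau> yb' vb'])
  have yb_target: "P_endpoint g (yb 0) (yb 1) \<in> P_target x0 T"
    using \<tau> xb0 zero by (simp add: P_endpoint_target_iff yb')
  have yb_cost: "P_cost \<phi> T (yb 1) = crisis_cost f \<phi> K x0 T ub"
  proof -
    have "crisis_cost f \<phi> K x0 T ub = \<phi> (xb T) + T - \<tau>"
    proof (rule crisis_cost_eq)
      show "xb t \<in> K" if "t \<in> {0..\<tau>}" for t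
        using neg[of t] zero that \<open>K = {x. g x \<le> 0}\<close> by (cases "t = \<tau>") auto
      show "xb t \<notin> K" if "t \<in> {\<tau><..T}" for t
        using pos[OF that] \<open>K = {x. g x \<le> 0}\<close> by auto
    qed (use xb \<tau> in auto)
    then show ?thesis
      by (simp add: P_cost_def yb')
  qed

  \<comment> \<open>A sequence of counterexamples and its limit\<close>
  have "\<exists>\<epsilon>>0. \<forall>(y, v)\<in>P_trajectories f T U.
        P_endpoint g (y 0) (y 1) \<in> P_target x0 T \<and> norm (y 0 - yb 0) \<le> \<epsilon> \<and>
        esssup (lebesgue_on {0..1}) (\<lambda>s. ereal (norm (v s - vb s))) \<le> ereal \<epsilon>
        \<longrightarrow> P_cost \<phi> T (yb 1) \<le> P_cost \<phi> T (y 1)"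
  proof (rule ccontr)
    assume no_eps: "\<not> ?thesis"
    define Q where "Q k y v \<longleftrightarrow> (y, v) \<in> P_trajectories f T U \<and> P_endpoint g (y 0) (y 1) \<in> P_target x0 T \<and>
        norm (y 0 - yb 0) \<le> 1 / Suc k \<and>
        esssup (lebesgue_on {0..1}) (\<lambda>s. ereal (norm (v s - vb s))) \<le> ereal (1 / Suc k) \<and>
        P_cost \<phi> T (y 1) < P_cost \<phi> T (yb 1)" for k y v
    have "\<exists>y v. Q k y v" for k
    proof (rule ccontr)
      assume "\<not> ?thesis"
      then have "\<forall>(y, v)\<in>P_trajectories f T U.
        P_endpoint g (y 0) (y 1) \<in> P_target x0 T \<and> norm (y 0 - yb 0) \<le> 1 / Suc k \<and>
        esssup (lebesgue_on {0..1}) (\<lambda>s. ereal (norm (v s - vb s))) \<le> ereal (1 / Suc k)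
        \<longrightarrow> P_cost \<phi> T (yb 1) \<le> P_cost \<phi> T (y 1)"
        by (auto simp: Q_def not_less simp del: of_nat_Suc)
      moreover have "(0::real) < 1 / Suc k" by simp
      ultimately show False
        using no_eps by blast
    qed
    then obtain Y V where "\<And>k. Q k (Y k) (V k)"
      by metis
    then have P: "(Y k, V k) \<in> P_trajectories f T U"
      and target: "P_endpoint g (Y k 0) (Y k 1) \<in> P_target x0 T"
      and Y_near: "norm (Y k 0 - yb 0) \<le> 1 / Suc k"
      and V_near: "esssup (lebesgue_on {0..1}) (\<lambda>s. ereal (norm (V k s - vb s))) \<le> ereal (1 / Suc k)"
      and less: "P_cost \<phi> T (Y k 1) < P_cost \<phi> T (yb 1)" for k
      unfolding Q_def by blast+
    define \<xi> where "\<xi> k = snd (snd (Y k 0))" for k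
    have start: "fst (Y k 0) = x0" and \<xi>: "0 < \<xi> k" "\<xi> k < T" and join: "fst (snd (Y k 0)) = fst (Y k 1)"
      and finish: "g (fst (Y k 1)) = 0" for k
      using target[of k] by (auto simp: P_endpoint_target_iff \<xi>_def)
    have inv_lim: "(\<lambda>k. 1 / real (Suc k)) \<longlonglongrightarrow> 0"
      by (rule LIMSEQ_Suc[OF lim_1_over_n])
    have \<xi>_lim: "\<xi> \<longlonglongrightarrow> \<tau>"
    proof (rule LIM_zero_cancel, rule Lim_null_comparison[OF always_eventually inv_lim], rule allI)
      fix k
      have "norm (\<xi> k - \<tau>) = norm (snd (snd (Y k 0 - yb 0)))"
        by (simp add: \<xi>_def yb')
      also have "\<dots> \<le> norm (Y k 0 - yb 0)"
        by (metis norm_snd_le order_trans prod.collapse)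
      finally show "norm (\<xi> k - \<tau>) \<le> 1 / real (Suc k)"
        using Y_near[of k] by simp
    qed
    have "AE s in lebesgue_on {0..1}. norm (V k s - vb s) \<le> 1 / Suc k" for k
      using esssup_AE[where M="lebesgue_on {0..1}" and f="\<lambda>s. ereal (norm (V k s - vb s))"]
    proof eventually_elim
      case (elim s)
      then show ?case
        using order_trans[OF elim V_near[of k]] by simp
    qed
    then have V_AE: "AE s in lebesgue_on {0..1}. \<forall>k. norm (V k s - vb s) \<le> 1 / Suc k"
      by (simp add: AE_all_countable)
    then have "AE s in lebesgue_on {0..1}. (\<lambda>k. V k s) \<longlonglongrightarrow> (ub (\<tau> * s), ub ((T - \<tau>) * s + \<tau>))"
    proof (rule AE_mp, intro AE_I2 impI)
      fix s assume s: "s \<in> space (lebesgue_on {0..1})" and near: "\<forall>k. norm (V k s - vb s) \<le> 1 / Suc k"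
      have "(\<lambda>k. V k s) \<longlonglongrightarrow> vb s"
        by (rule LIM_zero_cancel, rule Lim_null_comparison[OF always_eventually inv_lim]) (use near in auto)
      then show "(\<lambda>k. V k s) \<longlonglongrightarrow> (ub (\<tau> * s), ub ((T - \<tau>) * s + \<tau>))"
        using s vb'[of s] by simp
    qed
    from P_trajectories_subconverge[OF growth \<open>c1 > 0\<close> \<open>c2 > 0\<close> cont ub unique traj \<tau> P start \<xi>_def \<xi> \<xi>_lim join this]
    obtain \<kappa> where \<kappa>: "strict_mono (\<kappa> :: nat \<Rightarrow> nat)"
      and unif: "\<And>e. e > 0 \<Longrightarrow> \<exists>N. \<forall>k\<ge>N. \<forall>s\<in>{0..1}. norm (fst (Y (\<kappa> k) s) - xb (\<tau> * s)) < e"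
      by blast

    \<comment> \<open>A counterexample whose first half stays in K\<close>
    obtain N\<^sub>1 where N1: "\<forall>k\<ge>N\<^sub>1. \<forall>s\<in>{0..1}. norm (fst (Y (\<kappa> k) s) - xb (\<tau> * s)) < min (\<rho>/2) \<gamma>"
      using unif[of "min (\<rho>/2) \<gamma>"] \<open>\<rho> > 0\<close> \<open>\<gamma> > 0\<close> by auto
    obtain N\<^sub>2 where N2: "1 / real (Suc N\<^sub>2) < \<rho>/2"
      using nat_approx_posE[of "\<rho>/2"] \<open>\<rho> > 0\<close> by auto
    \<comment> \<open>One index serves both purposes: the subsequence is uniformly close from
      \<open>N\<^sub>1\<close> on, and \<open>j \<ge> N\<^sub>2\<close> makes the control tolerance
      \<open>1 / Suc j\<close> small, because a strictly increasing sequence of indices dominates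
      the identity.\<close>
    define j where "j = \<kappa> (max N\<^sub>1 N\<^sub>2)"
    have near_xb: "norm (fst (Y j s) - xb (\<tau> * s)) < \<rho>/2" "norm (fst (Y j s) - xb (\<tau> * s)) < \<gamma>" if "s \<in> {0..1}" for s
      using N1[rule_format, of "max N\<^sub>1 N\<^sub>2" s] that by (auto simp: j_def)
    have "j \<ge> N\<^sub>2"
      using seq_suble[OF \<kappa>, of "max N\<^sub>1 N\<^sub>2"] by (simp add: j_def)
    then have "1 / real (Suc j) \<le> 1 / real (Suc N\<^sub>2)"
      by (simp add: field_simps)
    with N2 have j_small: "1 / real (Suc j) < \<rho>/2"
      by simp
    \<comment> \<open>The point 1 is discarded along with the null set: it corresponds to the
      crossing time, where the value of \<open>ub\<close> need not be near its left limit
      \<open>um\<close>.\<close>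
    define N where "N = insert 1 {s\<in>{0..1}. \<not> norm (V j s - vb s) \<le> 1 / Suc j}"
    have "negligible N"
      using V_AE unfolding N_def negligible_insert
      by (subst AE_lebesgue_on_iff_negligible[symmetric]) (auto elim: eventually_mono)
    have scaled: "\<tau> * s \<in> {0..\<tau>}" if "s \<in> {0..1}" for s
      using that \<tau> mult_left_mono[of s 1 \<tau>] by auto
    have curve: "integral_curve (\<lambda>s z. \<xi> j *\<^sub>R f z (fst (V j s))) 0 1 (\<lambda>s. fst (Y j s))"
      by (rule P_trajectories_glue(2)[OF growth \<open>c1 > 0\<close> P \<xi>_def \<xi> join])
    have "g (fst (Y j s)) \<le> 0" if s: "s \<in> {0..1}" for s
    proof (cases "\<tau> * s \<le> a")
      case True
      then have "fst (Y j s) \<in> (\<Union>x\<in>xb ` {0..a}. ball x \<gamma>)"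
        using near_xb(2)[OF s] scaled[OF s] by (auto intro!: bexI[of _ "\<tau> * s"] simp: dist_norm norm_minus_commute)
      then have "g (fst (Y j s)) < 0"
        using \<gamma> by blast
      then show ?thesis by simp
    next
      case False
      have late: "\<tau> * r \<in> {a..\<tau>}" if "r \<in> {s..1}" for r
      proof -
        have "\<tau> * s \<le> \<tau> * r"
          using that \<tau> by (intro mult_left_mono) auto
        moreover have "\<tau> * r \<in> {0..\<tau>}"
          using that s by (intro scaled) auto
        ultimately show ?thesis
          using False unfolding atLeastAtMost_iff by linarith
      qed
      have in_ball: "norm (fst (Y j r) - xb \<tau>) < \<rho>" if "r \<in> {s..1}" for r
        using near_xb(1)[of r] a(3)[OF late[OF that]] that s
          norm_triangle_ineq[of "fst (Y j r) - xb (\<tau> * r)" "xb (\<tau> * r) - xb \<tau>"] by simp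
      have "g (fst (Y j s)) \<le> g (fst (Y j 1))"
      proof (rule C1_le_along_integral[OF deriv _ _ _ _ \<open>negligible N\<close>, where S="ball (xb \<tau>) \<rho>"])
        show "((\<lambda>r. \<xi> j *\<^sub>R f (fst (Y j r)) (fst (V j r))) has_integral fst (Y j 1) - fst (Y j s)) {s..1}"
          using integral_curve_has_integral[OF curve, of s 1] s by simp
        show "fst (Y j s) \<in> ball (xb \<tau>) \<rho>" "fst (Y j 1) \<in> ball (xb \<tau>) \<rho>"
          using in_ball[of s] in_ball[of 1] s by (auto simp: dist_norm norm_minus_commute)
        fix z r assume z: "z \<in> ball (xb \<tau>) \<rho>" and r: "r \<in> {s..1} - N"
        have r': "r \<in> {0..1}" "r < 1" "norm (V j r - vb r) \<le> 1 / Suc j"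
          using r s by (auto simp: N_def)
        have "\<tau> * r < \<tau>"
          using r' \<tau> by simp
        then have "norm (ub (\<tau> * r) - um) < \<rho>/2"
          using late[of r] r by (intro a(4)) auto
        moreover have "norm (fst (V j r) - ub (\<tau> * r)) \<le> norm (V j r - vb r)"
          using norm_fst_le[of "fst (V j r - vb r)" "snd (V j r - vb r)"] vb'[OF r'(1)] by (simp add: minus_prod_def)
        ultimately have "norm (fst (V j r) - um) < \<rho>"
          using r'(3) j_small norm_triangle_ineq[of "fst (V j r) - ub (\<tau> * r)" "ub (\<tau> * r) - um"] by simp
        then have "blinfun_apply (g' z) (f (fst (Y j r)) (fst (V j r))) > 0"
          using in_ball[of r] r z by (intro \<rho>) (auto simp: dist_norm norm_minus_commute)
        then show "0 \<le> blinfun_apply (g' z) (\<xi> j *\<^sub>R f (fst (Y j r)) (fst (V j r)))"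
          using \<xi>[of j] by (simp add: blinfun.scaleR_right)
      qed simp
      then show ?thesis
        using finish by simp
    qed
    then have "fst (Y j s) \<in> K" if "s \<in> {0..1}" for s
      using that \<open>K = {x. g x \<le> 0}\<close> by blast
    then obtain u where "u \<in> controls 0 T U" "crisis_cost f \<phi> K x0 T u \<le> P_cost \<phi> T (Y j 1)"
      using crisis_cost_le_P_cost[OF growth \<open>c1 > 0\<close> unique_trajectory P target] by blast
    then show False
      using minimizer less[of j] yb_cost by (force simp: global_minimizer_def)
  qed
  then show ?thesis
    unfolding P_weak_minimum_def using yb_P yb_target by blast
qed

end
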